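(* Let $W$ be the smooth part of the fundamental solution of $u_t=\int_{\mathbb R^N}J(x-y)(u(y,t)-u(x,t))\,dy$. There exists a constant $C>0$ depending only on $J$ and $N$ such that $$|W_t(x,t)|\le e^{-t}J(x)+C\,\frac{t}{(1+|x|)^{N+4}}\qquad\text{for all }x\in\mathbb R^N,\ t>0.$$
   Context: $J\in C_0^\infty(\mathbb R^N)$ is radially symmetric, $J\ge0$, $\int J=1$. The fundamental solution of $u_t=Lu$, $Lu(x,t)=\int J(x-y)(u(y,t)-u(x,t))\,dy$, can be written as $e^{-t}\delta+W(x,t)$, where $\delta$ is the Dirac measure at the origin and $W$ is a smooth function. Equivalently, $W$ is the solution (bounded on finite time intervals) of $W_t(x,t)=\int J(x-y)\big(W(y,t)-W(x,t)\big)\,dy+e^{-t}J(x)$ in $\mathbb R^N\times(0,\infty)$, $W(x,0)=0$. *)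

theory Defs
  imports "HOL-Analysis.Analysis"
begin

text \<open>All iterated directional derivatives are required to exist as Frechet derivatives;
  only used for open sets \<open>S\<close>, where this is the usual notion of a \<open>C\<^sup>k\<close> function.\<close>

primrec Ck_on :: "nat \<Rightarrow> 'a::real_normed_vector set \<Rightarrow> ('a \<Rightarrow> 'b::real_normed_vector) \<Rightarrow> bool" where
  "Ck_on 0 S f \<longleftrightarrow> continuous_on S f"
| "Ck_on (Suc k) S f \<longleftrightarrow>
     (\<forall>x\<in>S. f differentiable (at x)) \<and> (\<forall>v. Ck_on k S (\<lambda>x. frechet_derivative f (at x) v))"

definition smooth_on :: "'a::real_normed_vector set \<Rightarrow> ('a \<Rightarrow> 'b::real_normed_vector) \<Rightarrow> bool" where
  "smooth_on S f \<longleftrightarrow> (\<forall>k. Ck_on k S f)"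

definition dispersal_kernel :: "(real ^ 'n \<Rightarrow> real) \<Rightarrow> bool" where
  "dispersal_kernel J \<longleftrightarrow>
     smooth_on UNIV J \<and> compact (closure {x. J x \<noteq> 0}) \<and>
     (\<forall>x y. norm x = norm y \<longrightarrow> J x = J y) \<and>
     (\<forall>x. 0 \<le> J x) \<and> (LINT x|lborel. J x) = 1"

definition nonlocal_op :: "(real ^ 'n \<Rightarrow> real) \<Rightarrow> (real ^ 'n \<Rightarrow> real) \<Rightarrow> real ^ 'n \<Rightarrow> real" where
  "nonlocal_op J u x = (LINT y|lborel. J (x - y) * (u y - u x))"

text \<open>Write the fundamental solution of \<open>u\<^sub>t = L u\<close> (initial datum the Dirac measure \<open>\<delta>\<close> at the
  origin) as \<open>e\<^bsup>-t\<^esup> \<delta> + W\<close>.  Since \<open>J\<close> has integral 1, \<open>L \<delta> = J - \<delta>\<close>; hence the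
  singular terms in \<open>(e\<^bsup>-t\<^esup> \<delta> + W)\<^sub>t = L (e\<^bsup>-t\<^esup> \<delta> + W)\<close> cancel, leaving
  \<open>W\<^sub>t = L W + e\<^bsup>-t\<^esup> J\<close> with \<open>W = 0\<close> at time 0.  The values of \<open>W\<close> at negative times
  are irrelevant.  Boundedness on finite time intervals singles out \<open>W\<close> among all solutions.\<close>

definition smooth_part_of_fundamental_solution ::
    "(real ^ 'n \<Rightarrow> real) \<Rightarrow> (real ^ 'n \<Rightarrow> real \<Rightarrow> real) \<Rightarrow> bool" where
  "smooth_part_of_fundamental_solution J W \<longleftrightarrow>
     smooth_on (UNIV \<times> {0<..}) (\<lambda>(x, t). W x t) \<and>
     continuous_on (UNIV \<times> {0..}) (\<lambda>(x, t). W x t) \<and>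
     (\<forall>T>0. \<exists>M. \<forall>x. \<forall>t\<in>{0..T}. \<bar>W x t\<bar> \<le> M) \<and>
     (\<forall>x. W x 0 = 0) \<and>
     (\<forall>x. \<forall>t>0. (W x has_real_derivative
        (nonlocal_op J (\<lambda>y. W y t) x + exp (- t) * J x)) (at t))"

end

theory Submission
  imports Defs
begin

text \<open>
  Let \<open>T f = J * f\<close>, \<open>L = T - 1\<close> and let \<open>A = (1 + T) / 2\<close> (\<open>lazy\<close> below). Then
  \<open>L = 2 (A - 1)\<close>, so \<open>exp (t L)\<close> is the Poisson average of the powers of \<open>A\<close> with mean
  \<open>2 t\<close>, and since \<open>W\<^sub>t - e\<^bsup>-t\<^esup> J = L W\<close> it suffices to bound the functions
  \<open>A\<^bsup>k\<^esup> (1 - A) J\<close> pointwise by \<open>C (k + 1) (1 + \<bar>x\<bar>)\<^bsup>-N-4\<^esup>\<close>: the factor \<open>t\<close> is the mean of the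
  Poisson weights. Because \<open>T\<close> is self-adjoint, a Nash inequality
  gives \<open>u\<^sub>k = \<parallel>A\<^bsup>k\<^esup> J\<parallel>\<^sup>2 = O(k\<^bsup>-N/2\<^esup>)\<close> in \<open>L\<^sup>2\<close>, and the second differences of \<open>u\<close>, which
  dominate \<open>\<parallel>A\<^bsup>k\<^esup> (1 - A) J\<parallel>\<^sup>2\<close> because \<open>A \<ge> 0\<close>, decrease and hence decay two powers faster.
  Cauchy-Schwarz turns this into the sup bound \<open>O(k\<^bsup>-N/2-1\<^esup>)\<close>, which is sharp for \<open>\<bar>x\<bar>\<^sup>2 \<lesssim> k\<close>;
  outside this region the bound propagates from \<open>k\<close> to \<open>k + 1\<close> since
  \<open>T (1 + \<bar>x\<bar>\<^sup>2)\<^bsup>-(N+4)/2\<^esup> \<le> (1 + O(\<bar>x\<bar>\<^bsup>-2\<^esup>)) (1 + \<bar>x\<bar>\<^sup>2)\<^bsup>-(N+4)/2\<^esup>\<close>.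
\<close>

section \<open>Continuous functions of compact support\<close>

definition Cc :: "('a::euclidean_space \<Rightarrow> real) \<Rightarrow> bool" where
  "Cc f \<longleftrightarrow> continuous_on UNIV f \<and> (\<exists>R. \<forall>x. R < norm x \<longrightarrow> f x = 0)"

lemma Cc_continuous: "Cc f \<Longrightarrow> continuous_on UNIV f"
  by (simp add: Cc_def)

lemma Cc_borel: "Cc f \<Longrightarrow> f \<in> borel_measurable borel"
  by (simp add: Cc_def borel_measurable_continuous_onI)

lemma Cc_integrable:
  assumes "Cc f"
  shows "integrable lborel f"
proof -
  obtain R where R: "\<And>x. R < norm x \<Longrightarrow> f x = 0"
    using assms unfolding Cc_def by auto
  have "integrable lborel (\<lambda>x. indicator (cball 0 R) x *\<^sub>R f x)"
    by (intro borel_integrable_compact compact_cball continuous_on_subset[OF Cc_continuous[OF assms]]) auto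
  also have "(\<lambda>x. indicator (cball 0 R) x *\<^sub>R f x) = f"
    by (force simp: indicator_def dist_norm R)
  finally show ?thesis .
qed

lemma Cc_mult:
  assumes "Cc f" "continuous_on UNIV g"
  shows "Cc (\<lambda>x. f x * g x)" "Cc (\<lambda>x. g x * f x)"
  using assms unfolding Cc_def by (auto intro!: continuous_intros)

lemma Cc_mult_Cc: "Cc f \<Longrightarrow> Cc g \<Longrightarrow> Cc (\<lambda>x. f x * g x)"
  by (simp add: Cc_mult Cc_continuous)

lemma Cc_cmult: "Cc f \<Longrightarrow> Cc (\<lambda>x. c * f x)"
  by (rule Cc_mult) auto

lemma Cc_add:
  assumes "Cc f" "Cc g"
  shows "Cc (\<lambda>x. f x + g x)"
proof -
  obtain R S where "\<And>x. R < norm x \<Longrightarrow> f x = 0" "\<And>x. S < norm x \<Longrightarrow> g x = 0"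
    using assms unfolding Cc_def by auto
  then have "\<forall>x. max R S < norm x \<longrightarrow> f x + g x = 0" by auto
  then have "\<exists>R. \<forall>x. R < norm x \<longrightarrow> f x + g x = 0" by blast
  then show ?thesis using assms by (simp add: Cc_def continuous_on_add)
qed

lemma Cc_diff: "Cc f \<Longrightarrow> Cc g \<Longrightarrow> Cc (\<lambda>x. f x - g x)"
  using Cc_add[OF _ Cc_cmult[of g "-1"], of f] by simp

lemma Cc_half: "Cc f \<Longrightarrow> Cc (\<lambda>x. f x / 2)"
  using Cc_cmult[of f "1/2"] by simp

lemma Cc_abs: "Cc f \<Longrightarrow> Cc (\<lambda>x. \<bar>f x\<bar>)"
  unfolding Cc_def by (auto intro!: continuous_intros)

lemma Cc_shift:
  assumes "Cc f"
  shows "Cc (\<lambda>y. f (x - y))" "Cc (\<lambda>y. f (y - x))"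
proof -
  obtain R where R: "\<And>x. R < norm x \<Longrightarrow> f x = 0"
    using assms unfolding Cc_def by auto
  have "f (x - y) = 0 \<and> f (y - x) = 0" if "R + norm x < norm y" for y
  proof -
    have "norm y \<le> norm x + norm (y - x)" using norm_triangle_ineq[of x "y - x"] by simp
    then have "R < norm (y - x)" using that by linarith
    then show ?thesis using R by (simp add: norm_minus_commute)
  qed
  then show "Cc (\<lambda>y. f (x - y))" "Cc (\<lambda>y. f (y - x))"
    using assms unfolding Cc_def
    by (auto intro!: exI[of _ "R + norm x"] continuous_intros continuous_on_compose2[of UNIV f])
qed

lemma Cc_bounded:
  assumes "Cc f"
  obtains M where "M > 0" "\<And>x. \<bar>f x\<bar> \<le> M"
proof -
  obtain R where R: "\<And>x. R < norm x \<Longrightarrow> f x = 0"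
    using assms unfolding Cc_def by auto
  have "bounded (f ` cball 0 R)"
    by (intro compact_imp_bounded compact_continuous_image
        continuous_on_subset[OF Cc_continuous[OF assms]] compact_cball) auto
  then obtain M where M: "\<And>x. norm x \<le> R \<Longrightarrow> \<bar>f x\<bar> \<le> M"
    unfolding bounded_iff by fastforce
  have "\<bar>f x\<bar> \<le> max 1 M" for x
    using M[of x] R[of x] by (cases "norm x \<le> R") auto
  then show ?thesis by (rule that[of "max 1 M", rotated]) auto
qed

lemma integral_lborel_shift:
  fixes f :: "'a::euclidean_space \<Rightarrow> real"
  assumes [measurable]: "f \<in> borel_measurable borel"
  shows "(LINT y|lborel. f (y + a)) = (LINT y|lborel. f y)"
proof -
  have "integral\<^sup>L lborel f = integral\<^sup>L (distr lborel borel ((+) a)) f"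
    by (simp add: lborel_distr_plus)
  also have "\<dots> = (LINT y|lborel. f (a + y))"
    by (rule integral_distr) auto
  finally show ?thesis by (simp add: add.commute)
qed

lemma integral_lborel_uminus:
  fixes f :: "'a::euclidean_space \<Rightarrow> real"
  assumes [measurable]: "f \<in> borel_measurable borel"
  shows "(LINT y|lborel. f (- y)) = (LINT y|lborel. f y)"
proof -
  have "lborel = distr lborel borel (\<lambda>x::'a. 0 + (-1) *\<^sub>R x)"
    by (subst (1) lborel_affine[of "-1" "0::'a"]) (auto simp: density_1 one_ennreal_def[symmetric])
  then have "integral\<^sup>L lborel f = integral\<^sup>L (distr lborel borel (\<lambda>x::'a. 0 + (-1) *\<^sub>R x)) f"
    by simp
  also have "\<dots> = (LINT y|lborel. f (- y))"
    by (subst integral_distr) auto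
  finally show ?thesis by simp
qed

lemma integral_lborel_reflect:
  fixes f :: "'a::euclidean_space \<Rightarrow> real"
  assumes [measurable]: "f \<in> borel_measurable borel"
  shows "(LINT y|lborel. f (a - y)) = (LINT y|lborel. f y)"
proof -
  have "(LINT y|lborel. f (a - y)) = (LINT y|lborel. (\<lambda>z. f (- z)) (y + (- a)))" by simp
  also have "\<dots> = (LINT y|lborel. f (- y))" by (rule integral_lborel_shift) measurable
  finally show ?thesis by (simp add: integral_lborel_uminus)
qed

lemma Fubini_continuous_compact:
  fixes F :: "'a::euclidean_space \<Rightarrow> 'a \<Rightarrow> real"
  assumes "continuous_on UNIV (\<lambda>(x, y). F x y)"
    and "\<And>x y. R < norm x \<or> R < norm y \<Longrightarrow> F x y = 0"
  shows "(LINT x|lborel. LINT y|lborel. F x y) = (LINT y|lborel. LINT x|lborel. F x y)"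
proof -
  have "integrable lborel (\<lambda>p. indicator (cball 0 R \<times> cball 0 R) p *\<^sub>R (case p of (x, y) \<Rightarrow> F x y))"
    by (intro borel_integrable_compact compact_Times compact_cball continuous_on_subset[OF assms(1)]) auto
  also have "(\<lambda>p. indicator (cball 0 R \<times> cball 0 R) p *\<^sub>R (case p of (x, y) \<Rightarrow> F x y)) = (\<lambda>(x, y). F x y)"
    using assms(2) by (force simp: indicator_def dist_norm not_le)
  finally have "integrable (lborel \<Otimes>\<^sub>M lborel) (\<lambda>(x, y). F x y)"
    by (simp add: lborel_prod)
  from lborel_pair.Fubini_integral[OF this] show ?thesis by simp
qed

section \<open>Convolution and the L2 pairing\<close>

definition conv :: "('a::euclidean_space \<Rightarrow> real) \<Rightarrow> ('a \<Rightarrow> real) \<Rightarrow> 'a \<Rightarrow> real" where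
  "conv f g x = (LINT y|lborel. f (x - y) * g y)"

definition ip :: "('a::euclidean_space \<Rightarrow> real) \<Rightarrow> ('a \<Rightarrow> real) \<Rightarrow> real" where
  "ip f g = (LINT x|lborel. f x * g x)"

text \<open>Compact support of one factor suffices; this lets \<open>conv J\<close> act on constants
  and on the weights \<open>1 / wt x ^ m\<close>, which do not vanish at infinity.\<close>

lemma conv_integrable:
  assumes "Cc f" "continuous_on UNIV g"
  shows "integrable lborel (\<lambda>y. f (x - y) * g y)"
  by (intro Cc_integrable Cc_mult Cc_shift assms)

lemma conv_altdef:
  assumes "Cc f" and g: "continuous_on UNIV g"
  shows "conv f g x = (LINT z|lborel. f z * g (x - z))"
proof -
  have [measurable]: "f \<in> borel_measurable borel" "g \<in> borel_measurable borel"
    using assms by (auto intro: borel_measurable_continuous_onI Cc_borel)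
  have "(\<lambda>z. f z * g (x - z)) \<in> borel_measurable borel" by measurable
  from integral_lborel_reflect[OF this, of x] show ?thesis
    by (simp add: conv_def)
qed

text \<open>Continuity is dominated convergence with majorant \<open>M * \<bar>g y\<bar>\<close>;
  the support lies in a ball whose radius is the sum of the two radii.\<close>

lemma conv_Cc:
  assumes f: "Cc f" and g: "Cc g"
  shows "Cc (conv f g)"
proof -
  obtain R where R: "\<And>x. R < norm x \<Longrightarrow> f x = 0" using f unfolding Cc_def by auto
  obtain S where S: "\<And>x. S < norm x \<Longrightarrow> g x = 0" using g unfolding Cc_def by auto
  obtain M where M: "\<And>x. \<bar>f x\<bar> \<le> M" using Cc_bounded[OF f] by metis
  note [measurable] = Cc_borel[OF f] Cc_borel[OF g]
  have "continuous_on UNIV (conv f g)"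
    unfolding continuous_on_sequentially o_def
  proof (intro allI ballI impI; elim conjE)
    fix x :: "nat \<Rightarrow> 'a" and a assume lim: "x \<longlonglongrightarrow> a"
    show "(\<lambda>n. conv f g (x n)) \<longlonglongrightarrow> conv f g a"
      unfolding conv_def
    proof (rule integral_dominated_convergence[where w="\<lambda>y. M * \<bar>g y\<bar>"])
      show "integrable lborel (\<lambda>y. M * \<bar>g y\<bar>)"
        by (intro Cc_integrable Cc_cmult Cc_abs g)
      show "AE y in lborel. (\<lambda>n. f (x n - y) * g y) \<longlonglongrightarrow> f (a - y) * g y"
        using lim
        by (intro always_eventually allI tendsto_intros continuous_on_tendsto_compose[OF Cc_continuous[OF f]]) auto
      show "AE y in lborel. norm (f (x n - y) * g y) \<le> M * \<bar>g y\<bar>" for n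
        by (intro always_eventually allI) (simp add: abs_mult mult_right_mono M)
    qed measurable
  qed
  moreover have "conv f g x = 0" if "R + S < norm x" for x
  proof -
    have "f (x - y) * g y = 0" for y
    proof (cases "S < norm y")
      case False
      then have "R < norm (x - y)" using that norm_triangle_ineq2[of x y] by linarith
      then show ?thesis by (simp add: R)
    qed (simp add: S)
    then show ?thesis by (simp only: conv_def Bochner_Integration.integral_zero)
  qed
  ultimately show ?thesis unfolding Cc_def by blast
qed

text \<open>Fubini moves the convolution to the other side of the pairing. The cases of interest are
  h = 1 (total mass), the symmetry of convolution with an even kernel, and the link with
  correlations.\<close>

lemma ip_conv:
  assumes f: "Cc f" and g: "Cc g" and h: "continuous_on UNIV h"
  shows "ip h (conv f g) = ip (\<lambda>y. LINT x|lborel. h x * f (x - y)) g"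
proof -
  obtain R where R: "\<And>x. R < norm x \<Longrightarrow> f x = 0" using f unfolding Cc_def by auto
  obtain S where S: "\<And>x. S < norm x \<Longrightarrow> g x = 0" using g unfolding Cc_def by auto
  have "ip h (conv f g) = (LINT x|lborel. LINT y|lborel. h x * f (x - y) * g y)"
    unfolding ip_def conv_def by (simp add: mult.assoc)
  also have "\<dots> = (LINT y|lborel. LINT x|lborel. h x * f (x - y) * g y)"
  \<comment> \<open>\<open>R\<close> and \<open>S\<close> may be negative; the absolute values make
    the common radius exceed \<open>S\<close>, which is needed when only \<open>y\<close> is
    large.\<close>
  proof (rule Fubini_continuous_compact[where R="\<bar>R\<bar> + \<bar>S\<bar>"])
    have "continuous_on UNIV (\<lambda>p::'a\<times>'a. h (fst p) * f (fst p - snd p) * g (snd p))"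
      by (intro continuous_intros continuous_on_compose2[OF h] continuous_on_compose2[OF Cc_continuous[OF f]]
           continuous_on_compose2[OF Cc_continuous[OF g]]) auto
    then show "continuous_on UNIV (\<lambda>(x, y). h x * f (x - y) * g y)" by (simp add: case_prod_beta')
    show "h x * f (x - y) * g y = 0" if "\<bar>R\<bar> + \<bar>S\<bar> < norm x \<or> \<bar>R\<bar> + \<bar>S\<bar> < norm y" for x y
    proof (cases "S < norm y")
      case False
      then have "R < norm (x - y)" using that norm_triangle_ineq2[of x y] by linarith
      then show ?thesis by (simp add: R)
    qed (simp add: S)
  qed
  finally show ?thesis unfolding ip_def by simp
qed

lemma integral_conv:
  assumes f: "Cc f" and g: "Cc g"
  shows "integral\<^sup>L lborel (conv f g) = integral\<^sup>L lborel f * integral\<^sup>L lborel g"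
proof -
  note [measurable] = Cc_borel[OF f] Cc_borel[OF g]
  have "(LINT x|lborel. f (x - y)) = integral\<^sup>L lborel f" for y
    using integral_lborel_shift[of f "-y"] by simp
  then show ?thesis
    using ip_conv[OF f g, of "\<lambda>_. 1"] by (simp add: ip_def)
qed

section \<open>Autocorrelation, translations and the Nash inequality\<close>

lemma ip_commute: "ip f g = ip g f"
  by (simp add: ip_def mult.commute)

lemma ip_lin:
  assumes "Cc f" "Cc g" "Cc h"
  shows "ip (\<lambda>x. a * f x + b * g x) h = a * ip f h + b * ip g h"
proof -
  have "integrable lborel (\<lambda>x. f x * h x)" "integrable lborel (\<lambda>x. g x * h x)"
    by (intro Cc_integrable Cc_mult_Cc assms)+
  then show ?thesis
    by (simp add: ip_def distrib_right mult.assoc)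
qed

lemma ip_quad:
  assumes "Cc f" "Cc g"
  shows "ip (\<lambda>x. a * f x + b * g x) (\<lambda>x. a * f x + b * g x) = a\<^sup>2 * ip f f + 2 * a * b * ip f g + b\<^sup>2 * ip g g"
proof -
  have c: "Cc (\<lambda>x. a * f x + b * g x)" by (intro Cc_add Cc_cmult assms)
  have "ip (\<lambda>x. a * f x + b * g x) (\<lambda>x. a * f x + b * g x)
      = a * ip (\<lambda>x. a * f x + b * g x) f + b * ip (\<lambda>x. a * f x + b * g x) g"
    by (subst ip_lin[OF assms c]) (simp add: ip_commute)
  also have "\<dots> = a * (a * ip f f + b * ip g f) + b * (a * ip f g + b * ip g g)"
    by (simp only: ip_lin[OF assms assms(1)] ip_lin[OF assms assms(2)])
  finally show ?thesis by (simp add: ip_commute[of g f] power2_eq_square algebra_simps)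
qed

lemma ip_nonneg: "0 \<le> ip f f"
  by (simp add: ip_def)

lemma ip_Cauchy_Schwarz:
  assumes "Cc f" "Cc g"
  shows "(ip f g)\<^sup>2 \<le> ip f f * ip g g"
proof (cases "ip g g = 0")
  case True
  \<comment> \<open>When \<open>ip g g\<close> vanishes the quadratic in \<open>b\<close> is affine;
    being nonnegative for every \<open>b\<close>, it must have slope zero.\<close>
  have *: "0 \<le> ip f f + 2 * b * ip f g" for b
    using ip_quad[OF assms, of 1 b] ip_nonneg[of "\<lambda>x. 1 * f x + b * g x"] True by simp
  have "ip f g = 0"
  proof (rule ccontr)
    assume "ip f g \<noteq> 0"
    then show False using *[of "- (ip f f + 1) / (2 * ip f g)"] by (simp add: field_simps)
  qed
  then show ?thesis using True by simp
next
  case False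
  then have pos: "ip g g > 0" using ip_nonneg[of g] by simp
  \<comment> \<open>This is the squared norm of \<open>ip g g\<close> times \<open>f\<close> minus
    \<open>ip f g\<close> times \<open>g\<close>, the component of \<open>f\<close> orthogonal to
    \<open>g\<close> up to scaling.\<close>
  have "0 \<le> ip g g * (ip f f * ip g g - (ip f g)\<^sup>2)"
    using ip_quad[OF assms, of "ip g g" "- ip f g"] ip_nonneg[of "\<lambda>x. ip g g * f x + - ip f g * g x"]
    by (simp add: power2_eq_square algebra_simps)
  then show ?thesis using pos by (simp add: zero_le_mult_iff)
qed

definition corr :: "('a::euclidean_space \<Rightarrow> real) \<Rightarrow> ('a \<Rightarrow> real) \<Rightarrow> 'a \<Rightarrow> real" where
  "corr f g z = (LINT x|lborel. f x * g (x - z))"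

lemma corr_eq_conv: "corr f g = conv (\<lambda>x. g (- x)) f"
  by (simp add: corr_def conv_def fun_eq_iff mult.commute)

lemma Cc_reflect: "Cc g \<Longrightarrow> Cc (\<lambda>x. g (- x))"
  using Cc_shift(1)[of g 0] by simp

lemma corr_Cc: "Cc f \<Longrightarrow> Cc g \<Longrightarrow> Cc (corr f g)"
  by (simp add: corr_eq_conv conv_Cc Cc_reflect)

lemma integral_corr:
  assumes "Cc f" "Cc g"
  shows "integral\<^sup>L lborel (corr f g) = integral\<^sup>L lborel f * integral\<^sup>L lborel g"
  using integral_conv[OF Cc_reflect[OF assms(2)] assms(1)] integral_lborel_uminus[OF Cc_borel[OF assms(2)]]
  by (simp add: corr_eq_conv mult.commute)

lemma ip_shift:
  assumes "Cc f" "Cc g"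
  shows "ip (\<lambda>x. f (x - z)) (\<lambda>x. g (x - z)) = ip f g"
proof -
  have "(\<lambda>x. f x * g x) \<in> borel_measurable borel"
    by (intro Cc_borel Cc_mult_Cc assms)
  from integral_lborel_shift[OF this, of "- z"] show ?thesis by (simp add: ip_def)
qed

lemma corr_ip: "corr f g z = ip f (\<lambda>x. g (x - z))"
  by (simp add: corr_def ip_def)

text \<open>Both the sum and the difference of \<open>f\<close> and a translate of \<open>g\<close>
  have nonnegative squared norm, and translation preserves the norm of \<open>g\<close>.\<close>

lemma corr_bound:
  assumes "Cc f" "Cc g"
  shows "\<bar>corr f g z\<bar> \<le> (ip f f + ip g g) / 2"
proof -
  have c: "Cc (\<lambda>x. g (x - z))" by (rule Cc_shift[OF assms(2)])
  have "0 \<le> ip f f + 2 * b * corr f g z + b\<^sup>2 * ip g g" for b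
    using ip_quad[OF assms(1) c, of 1 b] ip_nonneg[of "\<lambda>x. 1 * f x + b * g (x - z)"]
    by (simp add: corr_ip ip_shift assms)
  from this[of 1] this[of "-1"] show ?thesis by (simp add: abs_le_iff)
qed

definition tdiff :: "('a::euclidean_space \<Rightarrow> real) \<Rightarrow> 'a \<Rightarrow> real" where
  "tdiff f z = (LINT x|lborel. (f x - f (x - z))\<^sup>2)"

text \<open>Expanding the square links the L2 modulus of continuity with the autocorrelation, so
  smoothness of \<open>f\<close> keeps \<open>corr f f\<close> close to
  \<open>ip f f\<close>.\<close>

lemma tdiff_eq:
  assumes "Cc f"
  shows "tdiff f z = 2 * ip f f - 2 * corr f f z"
  using ip_quad[OF assms Cc_shift(2)[OF assms], of 1 "-1" z]
  by (simp add: tdiff_def ip_def[of "\<lambda>x. f x - f (x - z)"] power2_eq_square corr_ip ip_shift assms)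

lemma tdiff_nonneg: "0 \<le> tdiff f z"
  by (simp add: tdiff_def)

lemma tdiff_shift:
  assumes "Cc f"
  shows "(LINT x|lborel. (f (x - a) - f (x - a - z))\<^sup>2) = tdiff f z"
proof -
  have "(\<lambda>x. (f x - f (x - z))\<^sup>2) \<in> borel_measurable borel"
    unfolding power2_eq_square by (intro Cc_borel Cc_mult_Cc Cc_diff Cc_shift assms)
  from integral_lborel_shift[OF this, of "- a"] show ?thesis by (simp add: tdiff_def)
qed

lemma Cc_power2: "Cc f \<Longrightarrow> Cc (\<lambda>x. (f x)\<^sup>2)"
  unfolding power2_eq_square by (rule Cc_mult_Cc)

text \<open>The values at x and x - h are compared through x - h - z. Thus a small shift
  \<open>h\<close> is controlled by two larger shifts, which can be placed where the kernel is
  positive.\<close>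

lemma tdiff_add:
  assumes f: "Cc f"
  shows "tdiff f h \<le> 2 * tdiff f (z + h) + 2 * tdiff f z"
proof -
  note int = Cc_integrable[OF Cc_power2[OF Cc_diff[OF f Cc_shift(2)[OF f]]]]
  have s: "Cc (\<lambda>x. f (x - h - z))" using Cc_shift(2)[OF f, of "h + z"] by (simp add: diff_diff_eq)
  note int2 = Cc_integrable[OF Cc_power2[OF Cc_diff[OF Cc_shift(2)[OF f] s]]]
  have sq: "(u - v)\<^sup>2 \<le> 2 * u\<^sup>2 + 2 * v\<^sup>2" for u v :: real
    using sum_squares_bound[of u "- v"] by (simp add: power2_diff)
  have "tdiff f h \<le> (LINT x|lborel. 2 * (f x - f (x - (z + h)))\<^sup>2 + 2 * (f (x - h) - f (x - h - z))\<^sup>2)"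
    unfolding tdiff_def
  proof (rule integral_mono)
    fix x
    have e: "x - (z + h) = x - h - z" by (simp add: algebra_simps)
    have "(f x - f (x - h))\<^sup>2 = ((f x - f (x - h - z)) - (f (x - h) - f (x - h - z)))\<^sup>2" by simp
    also have "\<dots> \<le> 2 * (f x - f (x - h - z))\<^sup>2 + 2 * (f (x - h) - f (x - h - z))\<^sup>2"
      by (rule sq)
    finally show "(f x - f (x - h))\<^sup>2 \<le> 2 * (f x - f (x - (z + h)))\<^sup>2 + 2 * (f (x - h) - f (x - h - z))\<^sup>2"
      unfolding e .
  qed (use int int2 in auto)
  also have "\<dots> = 2 * tdiff f (z + h) + 2 * tdiff f z"
    by (subst Bochner_Integration.integral_add)
      (use int int2 in \<open>auto simp: tdiff_shift[OF f] tdiff_def[of f "z + h"]\<close>)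
  finally show ?thesis .
qed

text \<open>The long shift is telescoped into \<open>n\<close> shifts by \<open>h\<close>;
  Cauchy-Schwarz for the sum costs one factor \<open>n\<close>, the number of terms the
  other.\<close>

lemma tdiff_scale:
  assumes f: "Cc f"
  shows "tdiff f (real n *\<^sub>R h) \<le> (real n)\<^sup>2 * tdiff f h"
proof -
  have c: "Cc (\<lambda>x. (f (x - real i *\<^sub>R h) - f (x - real i *\<^sub>R h - h))\<^sup>2)" for i
    using Cc_power2[OF Cc_diff[OF Cc_shift(2)[OF f] Cc_shift(2)[OF f]], of "real i *\<^sub>R h" "real i *\<^sub>R h + h"]
    by (simp add: diff_diff_eq)
  have "tdiff f (real n *\<^sub>R h) \<le> (LINT x|lborel. real n * (\<Sum>i<n. (f (x - real i *\<^sub>R h) - f (x - real i *\<^sub>R h - h))\<^sup>2))"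
    unfolding tdiff_def
  proof (rule integral_mono)
    show "integrable lborel (\<lambda>x. (f x - f (x - real n *\<^sub>R h))\<^sup>2)"
      by (intro Cc_integrable Cc_power2 Cc_diff Cc_shift f)
    show "integrable lborel (\<lambda>x. real n * (\<Sum>i<n. (f (x - real i *\<^sub>R h) - f (x - real i *\<^sub>R h - h))\<^sup>2))"
      using Cc_integrable[OF c] by auto
    fix x
    have "f x - f (x - real n *\<^sub>R h) = (\<Sum>i<n. f (x - real i *\<^sub>R h) - f (x - real (Suc i) *\<^sub>R h))"
      by (simp add: sum_lessThan_telescope'[of "\<lambda>i. f (x - real i *\<^sub>R h)"] del: of_nat_Suc)
    also have "\<dots> = (\<Sum>i<n. f (x - real i *\<^sub>R h) - f (x - real i *\<^sub>R h - h))"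
      by (simp add: algebra_simps)
    finally show "(f x - f (x - real n *\<^sub>R h))\<^sup>2 \<le> real n * (\<Sum>i<n. (f (x - real i *\<^sub>R h) - f (x - real i *\<^sub>R h - h))\<^sup>2)"
      using sum_squared_le_sum_of_squares[of "\<lambda>i. f (x - real i *\<^sub>R h) - f (x - real i *\<^sub>R h - h)" "{..<n}"]
      by (simp add: mult.commute)
  qed
  also have "\<dots> = (real n)\<^sup>2 * tdiff f h"
    using Cc_integrable[OF c] by (simp add: tdiff_shift[OF f] power2_eq_square[of "real n"])
  finally show ?thesis .
qed

section \<open>Convolution with an even probability kernel, its Dirichlet form and a Nash
  inequality\<close>

locale symmetric_kernel =
  fixes J :: "'a::euclidean_space \<Rightarrow> real"
  assumes J: "Cc J" and J_nonneg: "0 \<le> J x" and J_even: "J (- x) = J x"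
    and J_mass: "integral\<^sup>L lborel J = 1"
begin

definition lazy :: "('a \<Rightarrow> real) \<Rightarrow> 'a \<Rightarrow> real" where
  "lazy f x = (f x + conv J f x) / 2"

lemma conv_lin:
  assumes "continuous_on UNIV f" "continuous_on UNIV g"
  shows "conv J (\<lambda>x. a * f x + b * g x) x = a * conv J f x + b * conv J g x"
proof -
  have "conv J (\<lambda>x. a * f x + b * g x) x = (LINT y|lborel. a * (J (x - y) * f y) + b * (J (x - y) * g y))"
    by (simp add: conv_def algebra_simps)
  then show ?thesis
    using conv_integrable[OF J, of _ x] assms by (simp add: conv_def)
qed

lemma conv_mono:
  assumes "continuous_on UNIV f" "continuous_on UNIV g" "\<And>x. f x \<le> g x"
  shows "conv J f x \<le> conv J g x"
  unfolding conv_def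
  by (intro integral_mono conv_integrable J assms mult_left_mono J_nonneg)

lemma conv_const: "conv J (\<lambda>_. c) x = c"
proof -
  have "(LINT y|lborel. J (x - y)) = 1"
    using integral_lborel_reflect[OF Cc_borel[OF J], of x] J_mass by simp
  then show ?thesis by (simp add: conv_def)
qed

lemma conv_abs_le:
  assumes "continuous_on UNIV f" "continuous_on UNIV g" "\<And>x. \<bar>f x\<bar> \<le> g x"
  shows "\<bar>conv J f x\<bar> \<le> conv J g x"
proof -
  have "- f y \<le> g y" "f y \<le> g y" for y
    using assms(3)[of y] by auto
  moreover have "conv J (\<lambda>y. - f y) x = - conv J f x"
    by (simp add: conv_def)
  moreover have "continuous_on UNIV (\<lambda>y. - f y)" using assms(1) by (intro continuous_intros)
  ultimately show ?thesis
    using conv_mono[of f g x] conv_mono[of "\<lambda>y. - f y" g x] assms by (auto simp: abs_le_iff)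
qed

lemma conv_sup:
  assumes "continuous_on UNIV f" "\<And>x. \<bar>f x\<bar> \<le> M"
  shows "\<bar>conv J f x\<bar> \<le> M"
  using conv_abs_le[of f "\<lambda>_. M"] assms by (simp add: conv_const)

lemma conv_sym:
  assumes "Cc f" "Cc g"
  shows "ip f (conv J g) = ip (conv J f) g"
proof -
  have "J (x - y) = J (y - x)" for x y using J_even[of "x - y"] by simp
  then have "(LINT x|lborel. f x * J (x - y)) = conv J f y" for y
    by (simp only: conv_def mult.commute[of "f _"])
  then show ?thesis
    using ip_conv[OF J assms(2) Cc_continuous[OF assms(1)]] by simp
qed

lemma ip_conv_corr:
  assumes "Cc f" "Cc g"
  shows "ip f (conv J g) = (LINT z|lborel. J z * corr f g z)"
proof -
  have "conv J g = conv g J"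
    using conv_altdef[OF J Cc_continuous[OF assms(2)]] by (simp add: fun_eq_iff conv_def mult.commute)
  then show ?thesis
    using ip_conv[OF assms(2) J Cc_continuous[OF assms(1)]]
    by (simp add: ip_def corr_def mult.commute)
qed

text \<open>By \<open>ip_conv_corr\<close> the pairing is an average of correlations against a
  probability density, and each correlation obeys \<open>corr_bound\<close>.\<close>

lemma ip_conv_bound:
  assumes "Cc f" "Cc g"
  shows "\<bar>ip f (conv J g)\<bar> \<le> (ip f f + ip g g) / 2"
proof -
  have "\<bar>ip f (conv J g)\<bar> \<le> (LINT z|lborel. J z * ((ip f f + ip g g) / 2))"
    unfolding ip_conv_corr[OF assms]
  proof (rule order_trans[OF integral_abs_bound integral_mono])
    show "integrable lborel (\<lambda>z. \<bar>J z * corr f g z\<bar>)"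
      by (intro Cc_integrable Cc_abs Cc_mult_Cc J corr_Cc assms)
    show "integrable lborel (\<lambda>z. J z * ((ip f f + ip g g) / 2))"
      using Cc_integrable[OF J] by auto
    show "\<bar>J z * corr f g z\<bar> \<le> J z * ((ip f f + ip g g) / 2)" for z
      unfolding abs_mult abs_of_nonneg[OF J_nonneg]
      by (rule mult_left_mono[OF corr_bound[OF assms] J_nonneg])
  qed
  then show ?thesis by (simp add: J_mass)
qed

text \<open>\<open>ip_conv_bound\<close> with \<open>conv J f\<close> in the first slot leaves half
  of the left side on the right, where it is absorbed.\<close>

lemma conv_contraction:
  assumes "Cc f"
  shows "ip (conv J f) (conv J f) \<le> ip f f"
  using ip_conv_bound[OF conv_Cc[OF J assms] assms] by simp

lemma lazy_Cc: "Cc f \<Longrightarrow> Cc (lazy f)"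
  unfolding lazy_def[abs_def] by (intro Cc_half Cc_add conv_Cc J)

lemma lazy_sym:
  assumes "Cc f" "Cc g"
  shows "ip f (lazy g) = ip (lazy f) g"
  using ip_lin[OF assms(1) conv_Cc[OF J assms(1)] assms(2), of "1/2" "1/2"]
    ip_lin[OF assms(2) conv_Cc[OF J assms(2)] assms(1), of "1/2" "1/2"] conv_sym[OF assms]
  by (simp add: lazy_def[abs_def] add_divide_distrib ip_commute)

text \<open>Expanding the square and bounding the norm of \<open>conv J f\<close> by that of
  \<open>f\<close> shows that each step dissipates at least half of the Dirichlet form. The last
  claim is nonnegativity of the operator, the reason for mixing in the identity.\<close>

lemma lazy_contraction:
  assumes "Cc f"
  shows "ip f f - ip (lazy f) (lazy f) \<ge> (ip f f - ip f (conv J f)) / 2"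
    and "ip (lazy f) (lazy f) \<le> ip f f"
    and "0 \<le> ip f (lazy f)"
proof -
  note T = conv_Cc[OF J assms]
  have "ip (lazy f) (lazy f) = ip f f / 4 + ip f (conv J f) / 2 + ip (conv J f) (conv J f) / 4"
    using ip_quad[OF assms T, of "1/2" "1/2"] by (simp add: lazy_def[abs_def] add_divide_distrib power2_eq_square)
  then show 1: "ip f f - ip (lazy f) (lazy f) \<ge> (ip f f - ip f (conv J f)) / 2"
    using conv_contraction[OF assms] by argo
  show "ip (lazy f) (lazy f) \<le> ip f f" using 1 ip_conv_bound[OF assms assms] by argo
  have "ip f (lazy f) = ip f f / 2 + ip f (conv J f) / 2"
    using ip_lin[OF assms T assms, of "1/2" "1/2"]
    by (simp add: lazy_def[abs_def] add_divide_distrib ip_commute)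
  then show "0 \<le> ip f (lazy f)" using ip_conv_bound[OF assms assms] by argo
qed

lemma Dirichlet_form:
  assumes "Cc f"
  shows "ip f f - ip f (conv J f) = (LINT z|lborel. J z * tdiff f z) / 2"
proof -
  have "(LINT z|lborel. J z * tdiff f z) = (LINT z|lborel. (2 * ip f f) * J z - 2 * (J z * corr f f z))"
    by (simp add: tdiff_eq[OF assms] algebra_simps)
  also have "\<dots> = 2 * ip f f - 2 * ip f (conv J f)"
    using Cc_integrable[OF J] Cc_integrable[OF Cc_mult_Cc[OF J corr_Cc[OF assms assms]]]
    by (simp add: J_mass ip_conv_corr[OF assms assms])
  finally show ?thesis by simp
qed

text \<open>The kernel may vanish near the origin, so short shifts are not seen directly by the
  Dirichlet form. Near some point p the kernel is bounded below; averaging \<open>tdiff_add\<close>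
  over z near p expresses a short shift by the shifts z and z + h.\<close>

lemma tdiff_local:
  obtains \<rho> K where "\<rho> > 0" "K > 0"
    "\<And>f h. Cc f \<Longrightarrow> norm h \<le> \<rho> \<Longrightarrow> tdiff f h \<le> K * (ip f f - ip f (conv J f))"
proof -
  have "\<exists>p. J p \<noteq> 0"
  proof (rule ccontr)
    assume "\<not> (\<exists>p. J p \<noteq> 0)"
    then have "J = (\<lambda>_. 0)" by auto
    then show False using J_mass by simp
  qed
  then obtain p where p: "J p > 0" using J_nonneg by (metis less_eq_real_def)
  have "isCont J p" using Cc_continuous[OF J] by (simp add: continuous_on_eq_continuous_at)
  then obtain d where d: "d > 0" "\<And>x. dist x p < d \<Longrightarrow> dist (J x) (J p) < J p / 2"
    using p unfolding continuous_at_eps_delta by (metis half_gt_zero)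
  define c where "c = J p / 2"
  \<comment> \<open>With a third of \<open>d\<close>, both z and z + h stay within distance
    \<open>d\<close> of p when z is within \<open>\<rho>\<close> of p and h has norm at most
    \<open>\<rho>\<close>.\<close>
  define \<rho> where "\<rho> = d / 3"
  define v where "v = measure lborel (cball p \<rho>)"
  have c: "c > 0" using p by (simp add: c_def)
  have Jc: "c \<le> J x" if "dist x p < d" for x
    using d(2)[OF that] unfolding dist_real_def c_def by linarith
  have \<rho>: "\<rho> > 0" using d by (simp add: \<rho>_def)
  have v: "v > 0" using \<rho> unfolding v_def by simp
  have "tdiff f h \<le> (8 / (c * v)) * (ip f f - ip f (conv J f))" if f: "Cc f" and h: "norm h \<le> \<rho>" for f h
  proof -
    let ?F = "\<lambda>z. J z * tdiff f z"
    have F: "Cc ?F"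
      unfolding tdiff_eq[OF f]
      by (intro Cc_mult J continuous_intros Cc_continuous[OF corr_Cc[OF f f]])
    have F': "Cc (\<lambda>z. ?F (z + h))" using Cc_shift(2)[OF F, of "- h"] by simp
    have "(LINT z|lborel. indicator (cball p \<rho>) z * (c * tdiff f h)) \<le> (LINT z|lborel. 2 * ?F (z + h) + 2 * ?F z)"
    proof (rule integral_mono)
      show "integrable lborel (\<lambda>z. indicator (cball p \<rho>) z * (c * tdiff f h))"
        by (intro integrable_mult_left integrable_real_indicator emeasure_bounded_finite bounded_cball) auto
      show "integrable lborel (\<lambda>z. 2 * ?F (z + h) + 2 * ?F z)"
        by (intro Cc_integrable Cc_add Cc_cmult F F')
      show "indicator (cball p \<rho>) z * (c * tdiff f h) \<le> 2 * ?F (z + h) + 2 * ?F z" for z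
      proof (cases "z \<in> cball p \<rho>")
        case True
        then have 1: "dist z p < d" using d \<rho> by (simp add: \<rho>_def dist_commute)
        have "dist (z + h) p \<le> dist z p + norm h"
          using norm_triangle_ineq[of "z - p" h] by (simp add: dist_norm algebra_simps)
        then have 2: "dist (z + h) p < d" using True h d by (simp add: \<rho>_def dist_commute)
        have "c * tdiff f h \<le> c * (2 * tdiff f (z + h) + 2 * tdiff f z)"
          using tdiff_add[OF f, of h z] c by simp
        also have "\<dots> \<le> 2 * ?F (z + h) + 2 * ?F z"
          using mult_right_mono[OF Jc[OF 1] tdiff_nonneg[of f z]]
            mult_right_mono[OF Jc[OF 2] tdiff_nonneg[of f "z + h"]] by argo
        finally show ?thesis using True by simp
      qed (use J_nonneg tdiff_nonneg[of f] in \<open>simp add: mult_nonneg_nonneg\<close>)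
    qed
    also have "\<dots> = 4 * (LINT z|lborel. ?F z)"
      using integral_lborel_shift[OF Cc_borel[OF F], of h] Cc_integrable[OF F] Cc_integrable[OF F'] by simp
    also have "\<dots> = 8 * (ip f f - ip f (conv J f))"
      using Dirichlet_form[OF f] by simp
    finally have "v * (c * tdiff f h) \<le> 8 * (ip f f - ip f (conv J f))"
      by (simp add: v_def)
    then show ?thesis using c v by (simp add: field_simps)
  qed
  then show ?thesis
    using that[of \<rho> "8 / (c * v)"] c v \<rho> by simp
qed

text \<open>For z of norm at most n times \<open>\<rho>\<close>, \<open>tdiff_scale\<close> and
  \<open>tdiff_local\<close> keep \<open>corr f f z\<close> above \<open>ip f f\<close> minus a
  multiple of n^2 times the Dirichlet form. Integrating over this ball and comparing with the total
  mass of \<open>corr f f\<close>, the square of the integral of \<open>f\<close>, gives the claim;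
  nonnegativity of \<open>f\<close> allows the rest of space to be discarded. The scale
  \<open>n\<close> stays free and is optimised later.\<close>

lemma Nash:
  obtains K where "K > 0"
    "\<And>f n. Cc f \<Longrightarrow> (\<And>x. 0 \<le> f x) \<Longrightarrow> n \<ge> 1 \<Longrightarrow> ip f f \<le>
       K * (real n)\<^sup>2 * (ip f f - ip f (conv J f)) + K * (integral\<^sup>L lborel f)\<^sup>2 / real n ^ DIM('a)"
proof -
  obtain \<rho> L where \<rho>: "\<rho> > 0" and L: "L > 0"
    and loc: "\<And>f h. Cc f \<Longrightarrow> norm h \<le> \<rho> \<Longrightarrow> tdiff f h \<le> L * (ip f f - ip f (conv J f))"
    using tdiff_local by metis
  define v where "v = unit_ball_vol (DIM('a)) * \<rho> ^ DIM('a)"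
  have v: "v > 0" using \<rho> by (simp add: v_def)
  have main: "ip f f \<le> L * (real n)\<^sup>2 * (ip f f - ip f (conv J f)) + (1 / v) * (integral\<^sup>L lborel f)\<^sup>2 / real n ^ DIM('a)"
    if f: "Cc f" and f0: "\<And>x. 0 \<le> f x" and n: "n \<ge> 1" for f and n :: nat
  proof -
    let ?B = "cball (0::'a) (real n * \<rho>)"
    let ?E = "ip f f - ip f (conv J f)"
    have vol: "measure lborel ?B = v * real n ^ DIM('a)"
      using \<rho> by (simp add: content_cball v_def power_mult_distrib)
    have E: "?E \<ge> 0" using ip_conv_bound[OF f f] by simp
    have intB: "integrable lborel (\<lambda>z. indicator ?B z * r)" for r :: real
      using \<rho> by (intro integrable_mult_left integrable_real_indicator emeasure_bounded_finite bounded_cball) auto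
    have "(LINT z|lborel. indicator ?B z * (ip f f - (real n)\<^sup>2 * L * ?E)) \<le> (LINT z|lborel. corr f f z)"
    proof (rule integral_mono[OF intB Cc_integrable[OF corr_Cc[OF f f]]])
      fix z
      show "indicator ?B z * (ip f f - (real n)\<^sup>2 * L * ?E) \<le> corr f f z"
      proof (cases "z \<in> ?B")
        case True
        then have "norm ((1 / real n) *\<^sub>R z) \<le> \<rho>" using n by (simp add: field_simps)
        from loc[OF f this] have "(real n)\<^sup>2 * tdiff f ((1 / real n) *\<^sub>R z) \<le> (real n)\<^sup>2 * (L * ?E)"
          by (intro mult_left_mono) auto
        moreover have "tdiff f z \<le> (real n)\<^sup>2 * tdiff f ((1 / real n) *\<^sub>R z)"
          using tdiff_scale[OF f, of n "(1 / real n) *\<^sub>R z"] n by simp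
        ultimately have "tdiff f z \<le> (real n)\<^sup>2 * L * ?E" by (simp add: mult.assoc)
        then have "ip f f - (real n)\<^sup>2 * L * ?E \<le> ip f f - tdiff f z / 2"
          using tdiff_nonneg[of f z] by simp
        then show ?thesis using True by (simp add: tdiff_eq[OF f])
      qed (simp add: corr_def f0)
    qed
    then have "measure lborel ?B * (ip f f - (real n)\<^sup>2 * L * ?E) \<le> (integral\<^sup>L lborel f)\<^sup>2"
      by (simp add: integral_corr[OF f f] power2_eq_square)
    then show ?thesis unfolding vol using v n by (simp add: field_simps)
  qed
  show ?thesis
  proof (rule that[of "max L (1 / v)"])
    fix f :: "'a \<Rightarrow> real" and n :: nat
    assume f: "Cc f" "\<And>x. 0 \<le> f x" "n \<ge> 1"
    have E: "0 \<le> ip f f - ip f (conv J f)" using ip_conv_bound[OF f(1) f(1)] by simp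
    have "L * (real n)\<^sup>2 * (ip f f - ip f (conv J f)) \<le> max L (1 / v) * (real n)\<^sup>2 * (ip f f - ip f (conv J f))"
      using E by (intro mult_right_mono) auto
    moreover have "(1 / v) * (integral\<^sup>L lborel f)\<^sup>2 / real n ^ DIM('a) \<le> max L (1 / v) * (integral\<^sup>L lborel f)\<^sup>2 / real n ^ DIM('a)"
      by (intro divide_right_mono mult_right_mono) auto
    ultimately show "ip f f \<le> max L (1 / v) * (real n)\<^sup>2 * (ip f f - ip f (conv J f)) + max L (1 / v) * (integral\<^sup>L lborel f)\<^sup>2 / real n ^ DIM('a)"
      using main[OF f] by linarith
  qed (use L in auto)
qed

end

section \<open>Decay of the powers of the lazy operator\<close>

lemma sqrt_power_mono_div:
  assumes "0 \<le> C" "real k + 1 \<le> c\<^sup>2 * (real j + 1)" "0 < c"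
  shows "C / sqrt (real j + 1) ^ m \<le> C * c ^ m / sqrt (real k + 1) ^ m"
proof -
  have "sqrt (real k + 1) \<le> sqrt (c\<^sup>2 * (real j + 1))" using assms by simp
  also have "\<dots> = c * sqrt (real j + 1)" using assms by (simp add: real_sqrt_mult)
  finally have "sqrt (real k + 1) ^ m \<le> (c * sqrt (real j + 1)) ^ m" by (rule power_mono) simp
  then have "C * sqrt (real k + 1) ^ m \<le> C * (c ^ m * sqrt (real j + 1) ^ m)"
    using assms(1) by (intro mult_left_mono) (simp_all add: power_mult_distrib)
  then show ?thesis by (simp add: field_simps)
qed

text \<open>With n of order sqrt (k + 1), either the remainder term dominates and u k already has
  the desired size, or u shrinks by a factor 1 - N / (k + 1), which beats the decrease of the target
  bound from k to k + 1.\<close>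

lemma power_decay_of_recursion:
  fixes u :: "nat \<Rightarrow> real"
  assumes u0: "\<And>k. 0 \<le> u k" and dec: "\<And>k. u (Suc k) \<le> u k" and K: "K > 0"
    and rec: "\<And>k n. n \<ge> 1 \<Longrightarrow> u k \<le> K * (real n)\<^sup>2 * (u k - u (Suc k)) + K / real n ^ N"
  obtains C where "C > 0" "\<And>k. u k \<le> C / sqrt (real k + 1) ^ N"
proof -
  \<comment> \<open>M^2 >= 2 K N makes the relative decrement 1 / (2 K n^2) at least N / (k + 1)
    whenever n M <= sqrt (k + 1).\<close>
  define M where "M = max 1 (sqrt (2 * K * real N))"
  have M1: "M \<ge> 1" by (simp add: M_def)
  have "sqrt (2 * K * real N) ^ 2 \<le> M ^ 2" unfolding M_def by (intro power_mono) (use K in auto)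
  then have M2: "2 * K * real N \<le> M\<^sup>2" using K by simp
  \<comment> \<open>The first summand serves the case in which the remainder dominates, the second
    the initial segment k + 1 < M^2.\<close>
  define C where "C = 2 * K * (2 * M) ^ N * 2 ^ N + u 0 * (2 * M) ^ N"
  have C: "C > 0" unfolding C_def using K M1 u0[of 0] by (intro add_pos_nonneg mult_pos_pos mult_nonneg_nonneg) auto
  have C1: "2 * K * (2 * M) ^ N * 2 ^ N \<le> C" "u 0 * (2 * M) ^ N \<le> C"
    unfolding C_def using K M1 u0[of 0] by (auto intro!: mult_nonneg_nonneg)
  have u_le: "u k \<le> u 0" for k
    by (induction k) (auto intro: order_trans[OF dec])
  have "u k \<le> C / sqrt (real k + 1) ^ N" for k
  proof (induction k)
    case 0
    have "1 \<le> (2 * M) ^ N" using M1 by (intro one_le_power) simp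
    then have "u 0 * 1 \<le> u 0 * (2 * M) ^ N" by (intro mult_left_mono u0)
    then show ?case using C1 by simp
  next
    case (Suc k)
    have pos: "0 < sqrt (real (Suc k) + 1) ^ N" "0 < sqrt (real k + 1) ^ N" by auto
    show ?case
    proof (cases "sqrt (real k + 1) < M")
      case True
      then have "real k + 1 < M\<^sup>2" using M1 power_strict_mono[of "sqrt (real k + 1)" M 2] by simp
      then have "real (Suc k) + 1 \<le> (2 * M)\<^sup>2 * (real 0 + 1)"
        using M1 one_le_power[OF M1, of 2] by (simp add: power_mult_distrib)
      from sqrt_power_mono_div[OF u0[of 0] this, of N]
      have "u 0 \<le> u 0 * (2 * M) ^ N / sqrt (real (Suc k) + 1) ^ N" using M1 by simp
      also have "\<dots> \<le> C / sqrt (real (Suc k) + 1) ^ N" using C1 pos by (intro divide_right_mono) auto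
      finally show ?thesis using u_le[of "Suc k"] by linarith
    next
      case False
      define n where "n = nat \<lfloor>sqrt (real k + 1) / M\<rfloor>"
      have q: "1 \<le> sqrt (real k + 1) / M" using False M1 by simp
      then have n1: "n \<ge> 1" unfolding n_def by linarith
      have n_le: "real n \<le> sqrt (real k + 1) / M" unfolding n_def using q by linarith
      \<comment> \<open>Rounding down a number that is at least 1 loses at most a factor 2.\<close>
      have n_ge: "sqrt (real k + 1) / (2 * M) \<le> real n"
      proof -
        have "sqrt (real k + 1) / M \<le> real n + 1" unfolding n_def using q by linarith
        also have "\<dots> \<le> 2 * real n" using n1 by simp
        finally show ?thesis using M1 by (simp add: field_simps)
      qed
      show ?thesis
      proof (cases "u k \<le> 2 * K / real n ^ N")
        case True
        have "2 * K / real n ^ N \<le> 2 * K / (sqrt (real k + 1) / (2 * M)) ^ N"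
          using n_ge n1 K M1 by (intro divide_left_mono power_mono mult_pos_pos) auto
        also have "\<dots> = 2 * K * (2 * M) ^ N / sqrt (real k + 1) ^ N" by (simp add: power_divide)
        also have "\<dots> \<le> 2 * K * (2 * M) ^ N * 2 ^ N / sqrt (real (Suc k) + 1) ^ N"
          using K M1 by (intro sqrt_power_mono_div) auto
        also have "\<dots> \<le> C / sqrt (real (Suc k) + 1) ^ N" using C1 pos by (intro divide_right_mono) auto
        finally show ?thesis using True dec[of k] by linarith
      next
        case False
        let ?x = "1 / (real k + 1)"
        have Kn: "0 < K * (real n)\<^sup>2" using K n1 by simp
        have "u k \<le> 2 * (K * (real n)\<^sup>2 * (u k - u (Suc k)))"
          using rec[OF n1, of k] False by simp
        then have s: "u (Suc k) \<le> u k - u k / (2 * (K * (real n)\<^sup>2))"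
        proof -
          have "u k / (2 * (K * (real n)\<^sup>2)) \<le> u k - u (Suc k)"
            using Kn \<open>u k \<le> 2 * (K * (real n)\<^sup>2 * (u k - u (Suc k)))\<close>
            by (subst pos_divide_le_eq) (simp_all add: mult_ac)
          then show ?thesis by linarith
        qed
        have "(real n)\<^sup>2 \<le> (sqrt (real k + 1) / M)\<^sup>2" using n_le by (intro power_mono) auto
        then have "(real n)\<^sup>2 * M\<^sup>2 \<le> real k + 1" using M1 by (simp add: power_divide field_simps)
        moreover have "(real n)\<^sup>2 * (2 * K * real N) \<le> (real n)\<^sup>2 * M\<^sup>2" by (intro mult_left_mono M2) simp
        ultimately have "real N * (2 * (K * (real n)\<^sup>2)) \<le> real k + 1" by (simp add: algebra_simps)
        then have "real N * ?x \<le> 1 / (2 * (K * (real n)\<^sup>2))"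
          using Kn by (simp add: field_simps)
        then have "u k * (real N * ?x) \<le> u k * (1 / (2 * (K * (real n)\<^sup>2)))"
          by (intro mult_left_mono u0)
        then have s2: "u (Suc k) \<le> u k * (1 - real N * ?x)" using s by (simp add: algebra_simps)
        have x: "0 \<le> ?x" "?x \<le> 1" by auto
        \<comment> \<open>Bernoulli replaces the linear factor by (1 - x)^N, and (1 - x)(1 + x) is
          at most 1.\<close>
        have bern: "(1 - real N * ?x) * (1 + ?x) ^ N \<le> 1"
        proof -
          have "(1 - real N * ?x) * (1 + ?x) ^ N \<le> (1 + - ?x) ^ N * (1 + ?x) ^ N"
            using Bernoulli_inequality[of "- ?x" N] x by (intro mult_right_mono) auto
          also have "\<dots> = (1 - ?x\<^sup>2) ^ N"
            unfolding power_mult_distrib[symmetric] by (simp add: algebra_simps power2_eq_square)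
          also have "\<dots> \<le> 1" using x by (intro power_le_one) (auto simp: abs_square_le_1 power_le_one)
          finally show ?thesis .
        qed
        have "sqrt (real (Suc k) + 1) \<le> sqrt (real k + 1) * (1 + ?x)"
        proof (rule real_le_lsqrt)
          have "real (Suc k) + 1 = (real k + 1) * (1 + ?x)" by (simp add: field_simps)
          also have "\<dots> \<le> (real k + 1) * (1 + ?x)\<^sup>2"
          proof (intro mult_left_mono)
            have "1 * (1 + ?x) \<le> (1 + ?x) * (1 + ?x)" by (rule mult_right_mono) auto
            then show "1 + ?x \<le> (1 + ?x)\<^sup>2" by (simp only: power2_eq_square mult_1_left)
          qed simp
          finally show "real (Suc k) + 1 \<le> (sqrt (real k + 1) * (1 + ?x))\<^sup>2"
            by (simp add: power_mult_distrib)
        qed auto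
        then have "sqrt (real (Suc k) + 1) ^ N \<le> (sqrt (real k + 1) * (1 + ?x)) ^ N"
          by (intro power_mono) auto
        then have r: "sqrt (real (Suc k) + 1) ^ N \<le> sqrt (real k + 1) ^ N * (1 + ?x) ^ N"
          by (simp only: power_mult_distrib)
        show ?thesis
        \<comment> \<open>The induction hypothesis can only be multiplied by a nonnegative factor;
          otherwise \<open>s2\<close> already makes the next term nonpositive.\<close>
        proof (cases "1 - real N * ?x \<le> 0")
          case True
          then have "u (Suc k) \<le> 0" using s2 u0[of k] by (meson mult_nonneg_nonpos order_trans)
          then show ?thesis using C pos by (meson divide_nonneg_pos less_eq_real_def order_trans)
        next
          case False
          have "u (Suc k) \<le> C / sqrt (real k + 1) ^ N * (1 - real N * ?x)"
            using s2 mult_right_mono[OF Suc.IH, of "1 - real N * ?x"] False by linarith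
          then have "u (Suc k) * sqrt (real (Suc k) + 1) ^ N
              \<le> (C / sqrt (real k + 1) ^ N * (1 - real N * ?x)) * (sqrt (real k + 1) ^ N * (1 + ?x) ^ N)"
            using r False C pos u0 by (intro mult_mono) auto
          also have "\<dots> = C * ((1 - real N * ?x) * (1 + ?x) ^ N)"
          proof -
            have "(C / p * a) * (p * b) = C * (a * b)" if "p > 0" for p a b :: real
              using that by simp
            then show ?thesis using pos(2) by blast
          qed
          also have "\<dots> \<le> C" using bern C by (simp add: mult_left_le)
          finally show ?thesis using pos by (simp add: field_simps)
        qed
      qed
    qed
  qed
  with C that show thesis by blast
qed

lemma sum_telescope_Suc:
  fixes v :: "nat \<Rightarrow> real"
  shows "(\<Sum>i<n. v (a + i) - v (Suc (a + i))) = v a - v (a + n)"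
  by (induction n) auto

text \<open>The j + 1 decrements of \<open>w\<close> from index j on add up to at most w j, and none
  of them is below the one at index 2 j.\<close>

lemma antimono_sum_le:
  fixes v w :: "nat \<Rightarrow> real"
  assumes "\<And>k. v k = w k - w (Suc k)" "\<And>k. v (Suc k) \<le> v k" "\<And>k. 0 \<le> w k"
  shows "(real j + 1) * v (2 * j) \<le> w j"
proof -
  have "decseq v" by (intro decseq_SucI assms)
  then have "(\<Sum>i<Suc j. v (2 * j)) \<le> (\<Sum>i<Suc j. v (j + i))"
    by (intro sum_mono) (auto simp: decseq_def)
  also have "\<dots> = w j - w (j + Suc j)"
    unfolding assms(1) by (rule sum_telescope_Suc)
  also have "\<dots> \<le> w j" using assms(3) by simp
  finally show ?thesis by (simp add: algebra_simps)
qed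

text \<open>\<open>antimono_sum_le\<close> is applied twice, to \<open>e\<close> against
  \<open>d\<close> and to \<open>d\<close> against \<open>u\<close>; each use gains a factor 1 / (j
  + 1) and doubles the index.\<close>

lemma second_difference_decay:
  fixes u d e :: "nat \<Rightarrow> real"
  assumes d: "\<And>k. d k = u k - u (Suc k)" and e: "\<And>k. e k = d k - d (Suc k)"
    and u0: "\<And>k. 0 \<le> u k" and d0: "\<And>k. 0 \<le> d k" and e0: "\<And>k. 0 \<le> e k"
    and dec: "\<And>k. e (Suc k) \<le> e k"
    and u: "\<And>k. u k \<le> C / sqrt (real k + 1) ^ N" and C: "C > 0"
  shows "e k \<le> C * 2 ^ (N + 4) / sqrt (real k + 1) ^ (N + 4)"
proof -
  \<comment> \<open>The two doublings lead from j to 4 j <= k, while k + 1 <= 4 (j + 1) allows the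
    return to k at the cost of a power of 2.\<close>
  define j where "j = k div 4"
  have "decseq e" by (intro decseq_SucI dec)
  then have "e k \<le> e (2 * (2 * j))" by (auto simp: decseq_def j_def)
  moreover have "(real j + 1) * ((real j + 1) * e (2 * (2 * j))) \<le> u j"
  proof -
    have "d (Suc k) \<le> d k" for k using e0[of k] by (simp add: e)
    with d u0 have 1: "(real j + 1) * d (2 * j) \<le> u j" by (intro antimono_sum_le[of d u]) auto
    have "(real (2 * j) + 1) * e (2 * (2 * j)) \<le> d (2 * j)"
      using e dec d0 by (intro antimono_sum_le[of e d]) auto
    moreover have "(real j + 1) * e (2 * (2 * j)) \<le> (real (2 * j) + 1) * e (2 * (2 * j))"
      by (intro mult_right_mono e0) simp
    ultimately have "(real j + 1) * ((real j + 1) * e (2 * (2 * j))) \<le> (real j + 1) * d (2 * j)"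
      by (intro mult_left_mono) auto
    with 1 show ?thesis by linarith
  qed
  ultimately have "(real j + 1)\<^sup>2 * e k \<le> u j"
    using mult_left_mono[of "e k" "e (2 * (2 * j))" "(real j + 1)\<^sup>2"]
    unfolding power2_eq_square mult.assoc by (meson order_trans zero_le_square mult.assoc of_nat_0_le_iff add_nonneg_nonneg zero_le_one mult_nonneg_nonneg)
  also have "\<dots> \<le> C / sqrt (real j + 1) ^ N" by (rule u)
  finally have "e k \<le> C / sqrt (real j + 1) ^ N / (real j + 1)\<^sup>2"
    by (subst pos_le_divide_eq) (simp_all add: mult.commute)
  also have "(real j + 1)\<^sup>2 = sqrt (real j + 1) ^ 4"
    using power_mult[of "sqrt (real j + 1)" 2 2] by simp
  also have "C / sqrt (real j + 1) ^ N / sqrt (real j + 1) ^ 4 = C / sqrt (real j + 1) ^ (N + 4)"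
    by (simp only: divide_divide_eq_left power_add)
  also have "\<dots> \<le> C * 2 ^ (N + 4) / sqrt (real k + 1) ^ (N + 4)"
    by (rule sqrt_power_mono_div) (use C in \<open>auto simp: j_def\<close>)
  finally show ?thesis .
qed

section \<open>Norm decay for the powers of the lazy operator\<close>

context symmetric_kernel
begin

lemma lazy_lin:
  assumes "Cc f" "Cc g"
  shows "lazy (\<lambda>x. a * f x + b * g x) = (\<lambda>x. a * lazy f x + b * lazy g x)"
  by (simp add: fun_eq_iff lazy_def conv_lin[OF Cc_continuous Cc_continuous] assms algebra_simps add_divide_distrib)

lemma lazy_diff: "Cc f \<Longrightarrow> Cc g \<Longrightarrow> lazy (\<lambda>x. f x - g x) = (\<lambda>x. lazy f x - lazy g x)"
  using lazy_lin[of f g 1 "-1"] by simp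

lemma conv_lazy_commute:
  assumes "Cc f"
  shows "conv J (lazy f) = lazy (conv J f)"
  using conv_lin[OF Cc_continuous Cc_continuous, OF assms conv_Cc[OF J assms], of "1/2" "1/2"]
  by (simp add: lazy_def[abs_def] fun_eq_iff add_divide_distrib)

lemma lazy_pow_Cc: "Cc f \<Longrightarrow> Cc ((lazy ^^ k) f)"
  by (induction k) (auto intro: lazy_Cc)

lemma lazy_pow_sym: "Cc f \<Longrightarrow> Cc g \<Longrightarrow> ip ((lazy ^^ k) f) g = ip f ((lazy ^^ k) g)"
  by (induction k arbitrary: g) (auto simp: lazy_sym[symmetric] lazy_pow_Cc lazy_Cc simp flip: funpow_swap1)

text \<open>Evenness of the kernel makes the operator commute with point reflections, so its powers
  can be moved onto the kernel inside a convolution integral.\<close>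

lemma lazy_reflect:
  assumes "Cc f"
  shows "lazy (\<lambda>y. f (x - y)) = (\<lambda>y. lazy f (x - y))"
proof -
  have "conv J (\<lambda>y. f (x - y)) y = conv J f (x - y)" for y
  proof -
    have b: "(\<lambda>w. J (x - y - w) * f w) \<in> borel_measurable borel"
      by (intro Cc_borel Cc_mult_Cc Cc_shift J assms)
    have "J (x - y - (x - z)) = J (y - z)" for z
      using J_even[of "y - z"] by (simp add: algebra_simps)
    then show ?thesis
      using integral_lborel_reflect[OF b, of x] by (simp add: conv_def)
  qed
  then show ?thesis by (simp add: lazy_def fun_eq_iff)
qed

lemma lazy_pow_reflect: "Cc f \<Longrightarrow> (lazy ^^ k) (\<lambda>y. f (x - y)) = (\<lambda>y. (lazy ^^ k) f (x - y))"
  by (induction k) (auto simp: lazy_reflect lazy_pow_Cc)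

lemma lazy_pow_J:
  shows "0 \<le> (lazy ^^ k) J x" "integral\<^sup>L lborel ((lazy ^^ k) J) = 1"
proof -
  have "(\<forall>x. 0 \<le> (lazy ^^ k) J x) \<and> integral\<^sup>L lborel ((lazy ^^ k) J) = 1"
  proof (induction k)
    case 0
    then show ?case by (simp add: J_nonneg J_mass)
  next
    case (Suc k)
    let ?f = "(lazy ^^ k) J"
    have f: "Cc ?f" by (intro lazy_pow_Cc J)
    have "0 \<le> conv J ?f x" for x
      unfolding conv_def by (intro Bochner_Integration.integral_nonneg mult_nonneg_nonneg J_nonneg) (use Suc in auto)
    moreover have "integral\<^sup>L lborel (lazy ?f) = 1"
      using Cc_integrable[OF f] Cc_integrable[OF conv_Cc[OF J f]] integral_conv[OF J f] Suc J_mass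
      by (simp add: lazy_def[abs_def])
    moreover have "0 \<le> lazy ?f x" if "0 \<le> conv J ?f x" for x
      unfolding lazy_def[of ?f] using that Suc by simp
    ultimately show ?case by simp
  qed
  then show "0 \<le> (lazy ^^ k) J x" "integral\<^sup>L lborel ((lazy ^^ k) J) = 1" by auto
qed

text \<open>The iterates are nonnegative with integral 1, so Nash applies with a fixed mass term;
  the Dirichlet form is at most twice the drop of the squared norm in one step.\<close>

lemma lazy_pow_J_L2_decay:
  obtains C where "C > 0" "\<And>k. ip ((lazy ^^ k) J) ((lazy ^^ k) J) \<le> C / sqrt (real k + 1) ^ DIM('a)"
proof -
  obtain K where K: "K > 0" and nash: "\<And>f n. Cc f \<Longrightarrow> (\<And>x. 0 \<le> f x) \<Longrightarrow> n \<ge> 1 \<Longrightarrow> ip f f \<le>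
       K * (real n)\<^sup>2 * (ip f f - ip f (conv J f)) + K * (integral\<^sup>L lborel f)\<^sup>2 / real n ^ DIM('a)"
    using Nash by metis
  let ?u = "\<lambda>k. ip ((lazy ^^ k) J) ((lazy ^^ k) J)"
  show ?thesis
  proof (rule power_decay_of_recursion[of ?u "2 * K" "DIM('a)"])
    fix k and n :: nat assume n: "n \<ge> 1"
    let ?f = "(lazy ^^ k) J"
    have f: "Cc ?f" by (intro lazy_pow_Cc J)
    have "ip ?f ?f - ip ?f (conv J ?f) \<le> 2 * (?u k - ?u (Suc k))"
      using lazy_contraction(1)[OF f] by simp
    then have "K * (real n)\<^sup>2 * (ip ?f ?f - ip ?f (conv J ?f)) \<le> K * (real n)\<^sup>2 * (2 * (?u k - ?u (Suc k)))"
      using K by (intro mult_left_mono) auto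
    moreover have "K / real n ^ DIM('a) \<le> 2 * K / real n ^ DIM('a)"
      using K by (intro divide_right_mono) auto
    ultimately show "?u k \<le> 2 * K * (real n)\<^sup>2 * (?u k - ?u (Suc k)) + 2 * K / real n ^ DIM('a)"
      using nash[OF f lazy_pow_J(1) n] unfolding lazy_pow_J by (simp only: power_one mult_1_right mult.assoc mult.left_commute[of 2])
  qed (use K lazy_contraction(2)[OF lazy_pow_Cc[OF J]] that in \<open>auto simp: ip_nonneg\<close>)
qed

text \<open>Minus one half of the generator \<open>conv J f - f\<close>, taken at f =
  \<open>(lazy ^^ k) J\<close>.\<close>

definition lazy_diff :: "nat \<Rightarrow> 'a \<Rightarrow> real" where
  "lazy_diff k x = (lazy ^^ k) J x - (lazy ^^ Suc k) J x"

lemma lazy_diff_Cc: "Cc (lazy_diff k)"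
  unfolding lazy_diff_def[abs_def] by (intro Cc_diff lazy_pow_Cc J)

lemma lazy_diff_Suc: "lazy_diff (Suc k) = lazy (lazy_diff k)"
  by (simp add: lazy_diff_def[abs_def] lazy_diff lazy_pow_Cc J lazy_Cc)

lemma lazy_diff_add: "lazy_diff (j + k) = (lazy ^^ j) (lazy_diff k)"
  by (induction j) (auto simp: lazy_diff_Suc)

text \<open>By self-adjointness the second difference \<open>e k\<close> of the squared norms is the
  squared norm of \<open>b k\<close>, the difference of iterates k and k + 2. It decreases because
  \<open>lazy\<close> maps \<open>b k\<close> to \<open>b (Suc k)\<close>. Moreover
  \<open>b k\<close> is \<open>lazy_diff k\<close> plus its image under \<open>lazy\<close>, and
  nonnegativity of \<open>lazy\<close> makes the cross term harmless.\<close>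

lemma lazy_diff_L2_decay:
  obtains C where "C > 0" "\<And>k. ip (lazy_diff k) (lazy_diff k) \<le> C / sqrt (real k + 1) ^ (DIM('a) + 4)"
proof -
  obtain C where C: "C > 0" "\<And>k. ip ((lazy ^^ k) J) ((lazy ^^ k) J) \<le> C / sqrt (real k + 1) ^ DIM('a)"
    using lazy_pow_J_L2_decay by metis
  let ?f = "\<lambda>k. (lazy ^^ k) J"
  define u where "u k = ip (?f k) (?f k)" for k
  define d where "d k = u k - u (Suc k)" for k
  define e where "e k = d k - d (Suc k)" for k
  define b where "b k = (\<lambda>x. ?f k x - ?f (Suc (Suc k)) x)" for k
  have f: "Cc (?f k)" for k by (intro lazy_pow_Cc J)
  have b: "Cc (b k)" for k unfolding b_def by (intro Cc_diff f)
  have "ip (?f k) (?f (Suc (Suc k))) = u (Suc k)" for k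
    using lazy_sym[OF f[of k] f[of "Suc k"]] by (simp add: u_def)
  then have eb: "e k = ip (b k) (b k)" for k
    using ip_quad[OF f[of k] f[of "Suc (Suc k)"], of 1 "-1"] by (simp add: e_def d_def u_def b_def)
  have bS: "b (Suc k) = lazy (b k)" for k
    by (simp add: b_def lazy_diff f lazy_Cc)
  have "e k \<le> C * 2 ^ (DIM('a) + 4) / sqrt (real k + 1) ^ (DIM('a) + 4)" for k
  proof (rule second_difference_decay[where u = u and d = d and e = e])
    show "d k = u k - u (Suc k)" "e k = d k - d (Suc k)" for k by (simp_all add: d_def e_def)
    show "0 \<le> e k" for k unfolding eb by (rule ip_nonneg)
    show "0 \<le> d k" for k using lazy_contraction(2)[OF f[of k]] by (simp add: d_def u_def)
    show "e (Suc k) \<le> e k" for k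
      unfolding eb bS by (rule lazy_contraction(2)[OF b])
  qed (use C ip_nonneg in \<open>auto simp: u_def\<close>)
  moreover have "ip (lazy_diff k) (lazy_diff k) \<le> e k" for k
  proof -
    have "b k = (\<lambda>x. 1 * lazy_diff k x + 1 * lazy (lazy_diff k) x)"
      by (simp add: b_def lazy_diff_def flip: lazy_diff_Suc)
    then have "e k = ip (lazy_diff k) (lazy_diff k) + 2 * ip (lazy_diff k) (lazy (lazy_diff k)) + ip (lazy (lazy_diff k)) (lazy (lazy_diff k))"
      unfolding eb using ip_quad[OF lazy_diff_Cc lazy_Cc[OF lazy_diff_Cc], of 1 k 1 k] by simp
    then show ?thesis using lazy_contraction(3)[OF lazy_diff_Cc] ip_nonneg[of "lazy (lazy_diff k)"] by simp
  qed
  ultimately show ?thesis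
    using that[of "C * 2 ^ (DIM('a) + 4)"] C(1) by (meson order_trans mult_pos_pos zero_less_power zero_less_numeral)
qed

lemma lazy_sup:
  assumes "continuous_on UNIV f" "\<And>x. \<bar>f x\<bar> \<le> M"
  shows "\<bar>lazy f x\<bar> \<le> M"
  using conv_sup[OF assms, of x] assms(2)[of x] by (simp add: lazy_def)

text \<open>The outer convolution turns a point value into an L2 pairing. Half of the powers go to
  each factor, and Cauchy-Schwarz takes the geometric mean of the rates with exponents N and N +
  4.\<close>

lemma conv_lazy_diff_sup_decay:
  obtains C where "C > 0" "\<And>k x. \<bar>conv J (lazy_diff k) x\<bar> \<le> C / sqrt (real k + 1) ^ (DIM('a) + 2)"
proof -
  let ?N = "DIM('a)"
  obtain C1 where C1: "C1 > 0" "\<And>k. ip ((lazy ^^ k) J) ((lazy ^^ k) J) \<le> C1 / sqrt (real k + 1) ^ ?N"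
    using lazy_pow_J_L2_decay by metis
  obtain C2 where C2: "C2 > 0" "\<And>k. ip (lazy_diff k) (lazy_diff k) \<le> C2 / sqrt (real k + 1) ^ (?N + 4)"
    using lazy_diff_L2_decay by metis
  define C where "C = sqrt (C1 * C2)"
  have C: "C > 0" using C1 C2 by (simp add: C_def)
  have even_case: "\<bar>conv J (lazy_diff (k + k)) x\<bar> \<le> C / sqrt (real k + 1) ^ (?N + 2)" for k x
  proof -
    let ?s = "sqrt (real k + 1)"
    have cJ: "Cc (\<lambda>y. J (x - y))" by (intro Cc_shift J)
    have "conv J (lazy_diff (k + k)) x = ip (\<lambda>y. J (x - y)) ((lazy ^^ k) (lazy_diff k))"
      by (simp add: conv_def ip_def lazy_diff_add)
    also have "\<dots> = ip (\<lambda>y. (lazy ^^ k) J (x - y)) (lazy_diff k)"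
      by (simp add: lazy_pow_sym[symmetric] cJ lazy_diff_Cc lazy_pow_reflect J)
    finally have eq: "conv J (lazy_diff (k + k)) x = ip (\<lambda>y. (lazy ^^ k) J (x - y)) (lazy_diff k)" .
    have b: "(\<lambda>y. (lazy ^^ k) J y * (lazy ^^ k) J y) \<in> borel_measurable borel"
      by (intro Cc_borel Cc_mult_Cc lazy_pow_Cc J)
    have "(conv J (lazy_diff (k + k)) x)\<^sup>2 \<le> ip ((lazy ^^ k) J) ((lazy ^^ k) J) * ip (lazy_diff k) (lazy_diff k)"
      unfolding eq
      using ip_Cauchy_Schwarz[OF Cc_shift(1)[OF lazy_pow_Cc[OF J]] lazy_diff_Cc, of k x k] integral_lborel_reflect[OF b, of x]
      by (simp add: ip_def)
    also have "\<dots> \<le> (C1 / ?s ^ ?N) * (C2 / ?s ^ (?N + 4))"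
      using C1 C2 ip_nonneg by (intro mult_mono) auto
    also have "\<dots> = (C / ?s ^ (?N + 2))\<^sup>2"
      using C1 C2 by (simp add: C_def power_divide power2_eq_square power_add numeral_eq_Suc mult_ac)
    finally show ?thesis using power2_le_imp_le[of "\<bar>conv J (lazy_diff (k + k)) x\<bar>" "C / ?s ^ (?N + 2)"] C by simp
  qed
  have "\<bar>conv J (lazy_diff k) x\<bar> \<le> C * 2 ^ (?N + 2) / sqrt (real k + 1) ^ (?N + 2)" for k x
  proof -
    \<comment> \<open>For odd \<open>k\<close> one more application of \<open>lazy\<close> is left
      over, and it does not increase the sup norm.\<close>
    define j where "j = k div 2"
    have "\<bar>conv J (lazy_diff k) x\<bar> \<le> C / sqrt (real j + 1) ^ (?N + 2)"
    proof (cases "even k")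
      case True
      then have "k = j + j" unfolding j_def by presburger
      then show ?thesis using even_case[of j] by simp
    next
      case False
      then have "k = Suc (j + j)" unfolding j_def by presburger
      then have "conv J (lazy_diff k) = lazy (conv J (lazy_diff (j + j)))" by (simp add: lazy_diff_Suc conv_lazy_commute lazy_diff_Cc)
      then show ?thesis
        using lazy_sup[OF Cc_continuous[OF conv_Cc[OF J lazy_diff_Cc]] even_case] by simp
    qed
    also have "\<dots> \<le> C * 2 ^ (?N + 2) / sqrt (real k + 1) ^ (?N + 2)"
    proof (rule sqrt_power_mono_div)
      have "k \<le> 2 * j + 1" by (simp add: j_def)
      then have "real k \<le> 2 * real j + 1" by linarith
      then show "real k + 1 \<le> 2\<^sup>2 * (real j + 1)" by simp
    qed (use C in auto)
    finally show ?thesis .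
  qed
  then show ?thesis using that[of "C * 2 ^ (?N + 2)"] C by simp
qed

end

section \<open>The parabolic barrier\<close>

text \<open>Comparable to 1 + norm x, but with a quadratic polynomial as its square, so that shifts
  expand exactly.\<close>

definition wt :: "'a::real_normed_vector \<Rightarrow> real" where
  "wt x = sqrt (1 + (norm x)\<^sup>2)"

lemma wt_ge_1: "1 \<le> wt x"
  by (simp add: wt_def)

lemma wt_pos: "0 < wt x"
  using wt_ge_1[of x] by linarith

lemma wt_power2: "(wt x)\<^sup>2 = 1 + (norm x)\<^sup>2"
  by (simp add: wt_def)

lemma norm_le_wt: "norm x \<le> wt x"
  unfolding wt_def by (rule real_le_rsqrt) simp

lemma continuous_wt: "continuous_on UNIV (\<lambda>x. c / wt x ^ m)"
  using wt_pos unfolding wt_def by (intro continuous_intros) (auto simp: add_nonneg_eq_0_iff)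

text \<open>A second-order Taylor bound obtained through the logarithm. The linear term is kept
  exactly because its odd part cancels when opposite shifts are added.\<close>

lemma inverse_sqrt_power_bound:
  fixes s :: real
  assumes s: "\<bar>s\<bar> \<le> \<delta>" and \<delta>: "\<delta> \<le> 1 / 2" "real m * \<delta> \<le> 1 / 2"
  shows "1 / sqrt (1 + s) ^ m \<le> 1 - real m / 2 * s + (real m + 2 * (real m)\<^sup>2) * \<delta>\<^sup>2"
proof -
  define v where "v = real m * (ln (1 + s) / 2)"
  have s2: "\<bar>s\<bar> \<le> 1 / 2" using s \<delta> by linarith
  have sd: "s\<^sup>2 \<le> \<delta>\<^sup>2" using power_mono[OF s, of 2] by simp
  have "sqrt (1 + s) = exp (ln (1 + s) / 2)"
    using s2 by (simp add: ln_sqrt[symmetric] abs_le_iff)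
  then have ev: "sqrt (1 + s) ^ m = exp v" by (simp only: v_def exp_of_nat_mult)
  have "v - real m / 2 * s = real m / 2 * (ln (1 + s) - s)" by (simp add: v_def algebra_simps)
  then have "\<bar>v - real m / 2 * s\<bar> = real m / 2 * \<bar>ln (1 + s) - s\<bar>" by (simp only: abs_mult abs_divide abs_of_nat abs_numeral)
  also have "\<dots> \<le> real m / 2 * (2 * \<delta>\<^sup>2)"
    using abs_ln_one_plus_x_minus_x_bound[OF s2] sd by (intro mult_left_mono) auto
  finally have vs: "\<bar>v - real m / 2 * s\<bar> \<le> real m * \<delta>\<^sup>2" by simp
  have "real m / 2 * \<bar>s\<bar> \<le> real m / 2 * \<delta>" by (intro mult_left_mono s) simp
  moreover have "real m * (\<delta> * \<delta>) \<le> real m * (1 / 2 * \<delta>)"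
    using s \<delta> by (intro mult_left_mono mult_right_mono) auto
  moreover have "\<bar>real m / 2 * s\<bar> = real m / 2 * \<bar>s\<bar>" by (simp add: abs_mult)
  ultimately have v: "\<bar>v\<bar> \<le> real m * \<delta>"
    using vs unfolding power2_eq_square by linarith
  then have v1: "- (1 / 2) \<le> v" using \<delta> by linarith
  have "v\<^sup>2 \<le> (real m * \<delta>)\<^sup>2" using power_mono[OF v, of 2] by simp
  then have v2: "v\<^sup>2 \<le> (real m)\<^sup>2 * \<delta>\<^sup>2" by (simp add: power_mult_distrib)
  have "1 / exp v \<le> 1 / (1 + v)"
    using v1 exp_ge_add_one_self[of v] by (intro divide_left_mono mult_pos_pos) auto
  \<comment> \<open>After multiplication by 1 + v the right side exceeds 1 by v^2 (1 + 2 v), which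
    is nonnegative for v >= -1/2.\<close>
  also have "\<dots> \<le> 1 - v + 2 * v\<^sup>2"
  proof -
    have "0 \<le> v\<^sup>2 * (1 + 2 * v)" using v1 by (intro mult_nonneg_nonneg) auto
    then have "1 \<le> (1 - v + 2 * v\<^sup>2) * (1 + v)" by (simp add: algebra_simps power2_eq_square)
    then show ?thesis using v1 by (subst pos_divide_le_eq) auto
  qed
  finally show ?thesis using vs v2 unfolding ev by (simp add: distrib_right)
qed

text \<open>The relative change of \<open>wt x\<close> squared under the shift z is at most
  \<open>D / wt x\<close>. The inner products with z cancel between the two opposite shifts and the
  term with norm z squared has a favourable sign, so only the quadratic error survives.\<close>

lemma wt_symmetric_difference:
  fixes x z :: "'a::real_inner"
  assumes z: "norm z \<le> R" and D: "D = R\<^sup>2 + 2 * R" "D / wt x \<le> 1 / 2" "real m * (D / wt x) \<le> 1 / 2"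
  shows "1 / wt (x - z) ^ m + 1 / wt (x + z) ^ m \<le> 2 * (1 / wt x ^ m * (1 + (real m + 2 * (real m)\<^sup>2) * D\<^sup>2 / (wt x)\<^sup>2))"
proof -
  let ?w = "wt x" let ?c = "(real m + 2 * (real m)\<^sup>2) * (D / ?w)\<^sup>2"
  have w: "?w > 0" by (rule wt_pos)
  have one: "1 / wt (x + y) ^ m \<le> 1 / ?w ^ m * (1 - real m / 2 * (((norm y)\<^sup>2 + 2 * (x \<bullet> y)) / ?w\<^sup>2) + ?c)"
    if y: "norm y \<le> R" for y
  proof -
    define s where "s = ((norm y)\<^sup>2 + 2 * (x \<bullet> y)) / ?w\<^sup>2"
    have "\<bar>x \<bullet> y\<bar> \<le> norm x * norm y" by (rule Cauchy_Schwarz_ineq2)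
    also have "\<dots> \<le> ?w * R" using y norm_le_wt[of x] w by (intro mult_mono) auto
    finally have 1: "\<bar>x \<bullet> y\<bar> \<le> ?w * R" .
    have "(norm y)\<^sup>2 \<le> R\<^sup>2" using y by (intro power_mono) auto
    also have "\<dots> \<le> ?w * R\<^sup>2" using wt_ge_1[of x] mult_right_mono[of 1 ?w "R\<^sup>2"] by simp
    finally have "\<bar>(norm y)\<^sup>2 + 2 * (x \<bullet> y)\<bar> \<le> ?w * D" using 1 zero_le_power2[of "norm y"] unfolding D(1) distrib_left mult.left_commute[of ?w 2] by linarith
    then have "\<bar>s\<bar> \<le> ?w * D / ?w\<^sup>2"
      unfolding s_def abs_divide using w by (simp add: divide_right_mono)
    then have s: "\<bar>s\<bar> \<le> D / ?w" using w by (simp add: power2_eq_square)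
    have "(wt (x + y))\<^sup>2 = ?w\<^sup>2 * (1 + s)"
    proof -
      have "?w\<^sup>2 * s = (norm y)\<^sup>2 + 2 * (x \<bullet> y)" unfolding s_def using w by simp
      then have "?w\<^sup>2 * (1 + s) = ?w\<^sup>2 + ((norm y)\<^sup>2 + 2 * (x \<bullet> y))" by (simp only: distrib_left mult_1_right)
      then show ?thesis unfolding wt_power2 by (simp add: power2_norm_eq_inner inner_simps inner_commute)
    qed
    then have "sqrt ((wt (x + y))\<^sup>2) = sqrt (?w\<^sup>2 * (1 + s))" by simp
    then have "wt (x + y) = ?w * sqrt (1 + s)"
      using w wt_pos[of "x + y"] by (simp add: real_sqrt_mult)
    then have "1 / wt (x + y) ^ m = 1 / ?w ^ m * (1 / sqrt (1 + s) ^ m)" by (simp add: power_mult_distrib)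
    also have "\<dots> \<le> 1 / ?w ^ m * (1 - real m / 2 * s + ?c)"
      using inverse_sqrt_power_bound[OF s D(2,3)] w by (intro mult_left_mono) auto
    finally show ?thesis by (simp add: s_def)
  qed
  have "1 / wt (x - z) ^ m + 1 / wt (x + z) ^ m
     \<le> 1 / ?w ^ m * (1 - real m / 2 * (((norm z)\<^sup>2 - 2 * (x \<bullet> z)) / ?w\<^sup>2) + ?c)
      + 1 / ?w ^ m * (1 - real m / 2 * (((norm z)\<^sup>2 + 2 * (x \<bullet> z)) / ?w\<^sup>2) + ?c)"
    using one[of z] one[of "- z"] z by simp
  also have "\<dots> = 1 / ?w ^ m * (2 + 2 * ?c - real m * ((norm z)\<^sup>2 / ?w\<^sup>2))"
  proof -
    have "F * (1 - p / 2 * ((a - b) / w) + c) + F * (1 - p / 2 * ((a + b) / w) + c) = F * (2 + 2 * c - p * (a / w))"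
      for F p a b w c :: real
      unfolding add_divide_distrib diff_divide_distrib by algebra
    then show ?thesis .
  qed
  also have "\<dots> \<le> 1 / ?w ^ m * (2 + 2 * ?c)"
    using w by (intro mult_left_mono) (simp_all del: of_nat_mult)
  also have "\<dots> = 2 * (1 / ?w ^ m * (1 + ?c))" by algebra
  finally show ?thesis by (simp add: power_divide)
qed

lemma Cc_le_wt:
  assumes "Cc f"
  obtains C where "C > 0" "\<And>x. \<bar>f x\<bar> \<le> C / wt x ^ m"
proof -
  have "Cc (\<lambda>x. f x * wt x ^ m)"
    unfolding wt_def by (intro Cc_mult assms continuous_intros)
  then obtain C where C: "C > 0" "\<And>x. \<bar>f x * wt x ^ m\<bar> \<le> C"
    by (rule Cc_bounded) blast
  have "\<bar>f x\<bar> \<le> C / wt x ^ m" for x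
    using C(2)[of x] wt_pos[of x] by (simp add: abs_mult field_simps)
  with C(1) that show ?thesis by blast
qed

section \<open>The weight as a supersolution and the pointwise bound\<close>

context symmetric_kernel
begin

lemma lazy_abs_le: "\<bar>f x\<bar> \<le> B \<Longrightarrow> \<bar>conv J f x\<bar> \<le> B \<Longrightarrow> \<bar>lazy f x\<bar> \<le> B"
  by (simp add: lazy_def)

lemma conv_wt:
  obtains C B where "C > 0" "B > 0"
    "\<And>x. B \<le> (wt x)\<^sup>2 \<Longrightarrow> conv J (\<lambda>y. 1 / wt y ^ m) x \<le> 1 / wt x ^ m * (1 + C / (wt x)\<^sup>2)"
proof -
  obtain R0 where R0: "\<And>x. R0 < norm x \<Longrightarrow> J x = 0" using J unfolding Cc_def by auto
  define R where "R = max R0 1"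
  have R: "R > 0" "\<And>x. R < norm x \<Longrightarrow> J x = 0" using R0 by (auto simp: R_def)
  define D where "D = R\<^sup>2 + 2 * R"
  have D: "D > 0" using R by (simp add: D_def add_pos_pos)
  \<comment> \<open>The summand 1 keeps this constant positive even for m = 0; the threshold
    \<open>?B\<close> enforces both smallness conditions of
    \<open>wt_symmetric_difference\<close>.\<close>
  let ?C = "(real m + 2 * (real m)\<^sup>2) * D\<^sup>2 + 1"
  let ?B = "(2 * D * (real m + 1))\<^sup>2"
  let ?\<Phi> = "\<lambda>y::'a. 1 / wt y ^ m"
  have "conv J ?\<Phi> x \<le> ?\<Phi> x * (1 + ?C / (wt x)\<^sup>2)" if x: "?B \<le> (wt x)\<^sup>2" for x
  proof -
    have w: "wt x > 0" by (rule wt_pos)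
    have "2 * D * (real m + 1) \<le> wt x" using power2_le_imp_le[OF x] w by simp
    then have Dw: "(real m + 1) * (D / wt x) \<le> 1 / 2" using w by (simp add: field_simps)
    have Dw0: "0 \<le> D / wt x" using D w by simp
    have Dw12: "D / wt x \<le> 1 / 2" "real m * (D / wt x) \<le> 1 / 2"
      using Dw Dw0 mult_nonneg_nonneg[of "real m" "D / wt x"] unfolding distrib_right by linarith+
    have \<Phi>: "continuous_on UNIV ?\<Phi>" by (rule continuous_wt)
    have i1: "Cc (\<lambda>z. J z * ?\<Phi> (x - z))" and i2: "Cc (\<lambda>z. J z * ?\<Phi> (x + z))"
      by (intro Cc_mult J continuous_on_compose2[OF \<Phi>] continuous_intros; simp)+
    have 1: "conv J ?\<Phi> x = (LINT z|lborel. J z * ?\<Phi> (x - z))"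
      by (rule conv_altdef[OF J \<Phi>])
    \<comment> \<open>Evenness of the kernel gives the convolution in reflected form; adding the two
      forms produces the symmetric difference.\<close>
    have 2: "conv J ?\<Phi> x = (LINT z|lborel. J z * ?\<Phi> (x + z))"
      unfolding 1 using integral_lborel_uminus[OF Cc_borel[OF i1]] by (simp add: J_even)
    have "2 * conv J ?\<Phi> x = (LINT z|lborel. J z * ?\<Phi> (x - z) + J z * ?\<Phi> (x + z))"
      using 1 2 Cc_integrable[OF i1] Cc_integrable[OF i2] by simp
    also have "\<dots> \<le> (LINT z|lborel. J z * (2 * (?\<Phi> x * (1 + ?C / (wt x)\<^sup>2))))"
    proof (rule integral_mono)
      show "integrable lborel (\<lambda>z. J z * ?\<Phi> (x - z) + J z * ?\<Phi> (x + z))"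
        by (intro Cc_integrable Cc_add i1 i2)
      show "integrable lborel (\<lambda>z. J z * (2 * (?\<Phi> x * (1 + ?C / (wt x)\<^sup>2))))"
        by (intro integrable_mult_left Cc_integrable J)
      fix z
      show "J z * ?\<Phi> (x - z) + J z * ?\<Phi> (x + z) \<le> J z * (2 * (?\<Phi> x * (1 + ?C / (wt x)\<^sup>2)))"
      proof (cases "norm z \<le> R")
        case True
        have "?\<Phi> (x - z) + ?\<Phi> (x + z) \<le> 2 * (?\<Phi> x * (1 + (real m + 2 * (real m)\<^sup>2) * D\<^sup>2 / (wt x)\<^sup>2))"
          by (rule wt_symmetric_difference[OF True D_def Dw12])
        also have "\<dots> \<le> 2 * (?\<Phi> x * (1 + ?C / (wt x)\<^sup>2))"
          using w by (intro mult_left_mono add_left_mono divide_right_mono) auto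
        finally show ?thesis
          unfolding distrib_left[symmetric] by (intro mult_left_mono J_nonneg)
      qed (simp add: R(2))
    qed
    also have "\<dots> = 2 * (?\<Phi> x * (1 + ?C / (wt x)\<^sup>2))" using J_mass by simp
    finally show ?thesis by linarith
  qed
  moreover have "?C > 0" by (intro add_nonneg_pos mult_nonneg_nonneg) auto
  moreover have "?B > 0" using D by simp
  ultimately show ?thesis using that by blast
qed

text \<open>Outside the parabolic region \<open>wt x\<^sup>2 \<le> B k\<close> the function \<open>(k + 1) / wt\<^bsup>N+4\<^esup>\<close>
  is a supersolution; inside that region the sup bound is already strong enough.\<close>

lemma parabolic_barrier:
  assumes g: "\<And>k. Cc (g k)" and gS: "\<And>k. g (Suc k) = lazy (g k)"
    and sup: "\<And>k x. \<bar>g k x\<bar> \<le> C1 / sqrt (real k + 1) ^ (N + 2)"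
  obtains C where "C > 0" "\<And>k x. \<bar>g k x\<bar> \<le> C * (real k + 1) / wt x ^ (N + 4)"
proof -
  let ?m = "N + 4"
  let ?\<Phi> = "\<lambda>y::'a. 1 / wt y ^ ?m"
  obtain C0 B0 where C0: "C0 > 0" and B0: "B0 > 0"
    and bar: "\<And>x::'a. B0 \<le> (wt x)\<^sup>2 \<Longrightarrow> conv J ?\<Phi> x \<le> ?\<Phi> x * (1 + C0 / (wt x)\<^sup>2)"
    by (rule conv_wt[of ?m]) blast
  obtain C2 where C2: "C2 > 0" "\<And>x. \<bar>g 0 x\<bar> \<le> C2 / wt x ^ ?m"
    by (rule Cc_le_wt[OF g[of 0]]) blast
  \<comment> \<open>B >= B0 makes the weight estimate available outside the parabolic region, and B
    >= C0 bounds its relative error by 1 / (k + 1), exactly the growth from k + 1 to k + 2.\<close>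
  define B where "B = max B0 C0"
  have B: "B > 0" "B0 \<le> B" "C0 \<le> B" using B0 by (auto simp: B_def)
  \<comment> \<open>The first summand starts the induction, the second covers the parabolic region,
    where \<open>wt x\<close> is at most sqrt B times sqrt (k + 2).\<close>
  define C where "C = C2 + \<bar>C1\<bar> * sqrt B ^ ?m"
  have C: "C > 0" "C2 \<le> C" "\<bar>C1\<bar> * sqrt B ^ ?m \<le> C"
    using C2 B unfolding C_def by (auto intro!: add_pos_nonneg)
  have "\<bar>g k x\<bar> \<le> C * (real k + 1) * ?\<Phi> x" for k x
  proof (induction k arbitrary: x)
    case 0
    have "C2 / wt x ^ ?m \<le> C / wt x ^ ?m" using C wt_pos[of x] by (intro divide_right_mono) auto
    then show ?case using C2(2)[of x] by simp
  next
    case (Suc k)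
    let ?k = "real k + 2"
    have w: "wt x > 0" by (rule wt_pos)
    show ?case
    proof (cases "(wt x)\<^sup>2 \<le> B * ?k")
      case True
      let ?r = "sqrt ?k"
      have "\<bar>g (Suc k) x\<bar> \<le> C1 / ?r ^ (N + 2)" using sup[of "Suc k" x] by (simp add: add.commute)
      also have "\<dots> \<le> \<bar>C1\<bar> / ?r ^ (N + 2)" by (intro divide_right_mono) auto
      also have "\<dots> = \<bar>C1\<bar> * ?k / ?r ^ ?m"
      proof -
        have "?r ^ ?m = ?r ^ (N + 2) * ?k" by (simp add: power_add numeral_eq_Suc)
        moreover have "\<bar>C1\<bar> / p = \<bar>C1\<bar> * ?k / (p * ?k)" for p by simp
        ultimately show ?thesis by metis
      qed
      also have "\<dots> \<le> \<bar>C1\<bar> * ?k * (sqrt B ^ ?m * ?\<Phi> x)"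
      proof -
        have "wt x \<le> sqrt B * ?r" using True w by (simp add: real_le_rsqrt flip: real_sqrt_mult)
        then have "wt x ^ ?m \<le> sqrt B ^ ?m * ?r ^ ?m"
          using w by (metis less_imp_le power_mono power_mult_distrib)
        then have "1 / ?r ^ ?m \<le> sqrt B ^ ?m * ?\<Phi> x" using w by (simp add: field_simps)
        from mult_left_mono[OF this, of "\<bar>C1\<bar> * ?k"] show ?thesis by simp
      qed
      also have "\<dots> = (\<bar>C1\<bar> * sqrt B ^ ?m) * (?k * ?\<Phi> x)" by (simp add: mult_ac)
      also have "\<dots> \<le> C * (?k * ?\<Phi> x)" using w by (intro mult_right_mono C) auto
      finally show ?thesis by (simp add: mult_ac add_ac)
    next
      case False
      have \<Phi>: "continuous_on UNIV (\<lambda>y::'a. C * (real k + 1) * ?\<Phi> y)"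
        using continuous_on_mult_left[OF continuous_wt] .
      have "\<bar>conv J (g k) x\<bar> \<le> conv J (\<lambda>y. C * (real k + 1) * ?\<Phi> y) x"
        by (rule conv_abs_le[OF Cc_continuous[OF g] \<Phi> Suc.IH])
      also have "\<dots> = C * (real k + 1) * conv J ?\<Phi> x"
        using conv_lin[OF continuous_wt continuous_wt, of "C * (real k + 1)" 1 ?m 0] by simp
      also have "\<dots> \<le> C * (real k + 1) * (?\<Phi> x * (1 + 1 / (real k + 1)))"
      proof (rule mult_left_mono)
        have "B * 1 \<le> B * ?k" using B by (intro mult_left_mono) auto
        then have "conv J ?\<Phi> x \<le> ?\<Phi> x * (1 + C0 / (wt x)\<^sup>2)" using B False by (intro bar) linarith
        also have "\<dots> \<le> ?\<Phi> x * (1 + 1 / (real k + 1))"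
        proof (intro mult_left_mono add_left_mono)
          have "C0 * (real k + 1) \<le> B * ?k" using B C0 by (intro mult_mono) auto
          then show "C0 / (wt x)\<^sup>2 \<le> 1 / (real k + 1)" using False w by (simp add: field_simps)
        qed (use w in auto)
        finally show "conv J ?\<Phi> x \<le> ?\<Phi> x * (1 + 1 / (real k + 1))" .
      qed (use C in auto)
      also have "\<dots> = C * ((real k + 1) * (1 + 1 / (real k + 1))) * ?\<Phi> x" by (simp only: mult_ac)
      also have "(real k + 1) * (1 + 1 / (real k + 1)) = ?k" by (simp add: field_simps)
      finally have 1: "\<bar>conv J (g k) x\<bar> \<le> C * ?k * ?\<Phi> x" .
      have "\<bar>g k x\<bar> \<le> C * (real k + 1) * ?\<Phi> x" by (rule Suc.IH)
      also have "\<dots> \<le> C * ?k * ?\<Phi> x" using C w by (intro mult_right_mono mult_left_mono) auto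
      finally have "\<bar>g (Suc k) x\<bar> \<le> C * ?k * ?\<Phi> x"
        using 1 unfolding gS by (intro lazy_abs_le)
      then show ?thesis by (simp add: add_ac)
    qed
  qed
  then show ?thesis using that[of C] C by simp
qed

text \<open>The sup bound, hence the barrier, concerns the convolved function. The convolution is
  removed by induction, since \<open>lazy_diff (Suc k)\<close> is the mean of
  \<open>lazy_diff k\<close> and its convolution.\<close>

lemma lazy_diff_bound:
  obtains C where "C > 0" "\<And>k x. \<bar>lazy_diff k x\<bar> \<le> C * (real k + 1) / wt x ^ (DIM('a) + 4)"
proof -
  let ?m = "DIM('a) + 4"
  obtain C1 where C1: "\<And>k x. \<bar>conv J (lazy_diff k) x\<bar> \<le> C1 / sqrt (real k + 1) ^ (DIM('a) + 2)"
    by (rule conv_lazy_diff_sup_decay) blast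
  obtain C where C: "C > 0" "\<And>k x. \<bar>conv J (lazy_diff k) x\<bar> \<le> C * (real k + 1) / wt x ^ ?m"
    by (rule parabolic_barrier[of "\<lambda>k. conv J (lazy_diff k)", OF conv_Cc[OF J lazy_diff_Cc] _ C1])
      (simp_all add: lazy_diff_Suc conv_lazy_commute lazy_diff_Cc)
  obtain C2 where C2: "C2 > 0" "\<And>x. \<bar>lazy_diff 0 x\<bar> \<le> C2 / wt x ^ ?m"
    by (rule Cc_le_wt[OF lazy_diff_Cc[of 0]]) blast
  have "\<bar>lazy_diff k x\<bar> \<le> (C + C2) * (real k + 1) / wt x ^ ?m" for k x
  proof (induction k)
    case 0
    have "C2 / wt x ^ ?m \<le> (C + C2) / wt x ^ ?m" using C wt_pos[of x] by (intro divide_right_mono) auto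
    then show ?case using C2(2)[of x] by simp
  next
    case (Suc k)
    have "C * (real k + 1) / wt x ^ ?m \<le> (C + C2) * (real k + 1) / wt x ^ ?m"
      using C2 wt_pos[of x] by (intro divide_right_mono mult_right_mono) auto
    then have "\<bar>lazy_diff (Suc k) x\<bar> \<le> (C + C2) * (real k + 1) / wt x ^ ?m"
      unfolding lazy_diff_Suc using C(2)[of k x] Suc.IH by (intro lazy_abs_le) linarith+
    also have "\<dots> \<le> (C + C2) * (real (Suc k) + 1) / wt x ^ ?m"
      using C C2 wt_pos[of x] by (intro divide_right_mono mult_left_mono) auto
    finally show ?case .
  qed
  then show ?thesis using that[of "C + C2"] C C2 by simp
qed

end

section \<open>The Cauchy problem and the series representation\<close>

context symmetric_kernel
begin

text \<open>The generator has sup norm at most 2, so the time derivative is at most 2 m exp (4 t)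
  plus the source bound; integration turns the first part into at most (m / 2) exp (4 t). The sign
  \<open>\<sigma>\<close> treats both one-sided bounds at once.\<close>

lemma cauchy_problem_step:
  fixes Z :: "'a \<Rightarrow> real \<Rightarrow> real"
  assumes cont: "\<And>t. 0 \<le> t \<Longrightarrow> continuous_on UNIV (\<lambda>x. Z x t)"
    and contt: "\<And>x. continuous_on {0..T} (Z x)" and Z0: "\<And>x. Z x 0 = 0"
    and der: "\<And>x t. 0 < t \<Longrightarrow> (Z x has_real_derivative (conv J (\<lambda>y. Z y t) x - Z x t + R x t)) (at t)"
    and R: "\<And>x t. 0 < t \<Longrightarrow> t \<le> T \<Longrightarrow> \<bar>R x t\<bar> \<le> \<epsilon>" and \<epsilon>: "0 \<le> \<epsilon>"
    and bd: "\<And>x t. 0 \<le> t \<Longrightarrow> t \<le> T \<Longrightarrow> \<bar>Z x t\<bar> \<le> m * exp (4 * t)" and m: "0 \<le> m"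
    and t: "0 \<le> t" "t \<le> T"
  shows "\<bar>Z x t\<bar> \<le> (m / 2 + \<epsilon> * T) * exp (4 * t)"
proof -
  have main: "\<sigma> * Z x t \<le> m / 2 * exp (4 * t) + \<epsilon> * t" if \<sigma>: "\<bar>\<sigma>\<bar> = 1" for \<sigma>
  proof -
    let ?F = "\<lambda>t. m / 2 * exp (4 * t) + \<epsilon> * t - \<sigma> * Z x t"
    have "?F 0 \<le> ?F t"
    proof (rule DERIV_nonneg_imp_increasing_open[OF t(1)])
      show "continuous_on {0..t} ?F"
        using t by (intro continuous_intros continuous_on_subset[OF contt]) auto
      fix s assume s: "0 < s" "s < t"
      let ?D = "conv J (\<lambda>y. Z y s) x - Z x s + R x s"
      have 1: "(?F has_real_derivative 2 * m * exp (4 * s) + \<epsilon> - \<sigma> * ?D) (at s)"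
        by (rule derivative_eq_intros der s refl | simp)+
      have "\<bar>conv J (\<lambda>y. Z y s) x\<bar> \<le> m * exp (4 * s)"
        using s t by (intro conv_sup cont bd) auto
      then have "\<bar>?D\<bar> \<le> 2 * (m * exp (4 * s)) + \<epsilon>"
        using bd[of s x] R[of s x] s t by linarith
      moreover have "\<sigma> * ?D \<le> \<bar>?D\<bar>" using abs_ge_self[of "\<sigma> * ?D"] unfolding abs_mult \<sigma> by simp
      ultimately have "0 \<le> 2 * m * exp (4 * s) + \<epsilon> - \<sigma> * ?D" by linarith
      with 1 show "\<exists>y. (?F has_real_derivative y) (at s) \<and> 0 \<le> y" by blast
    qed
    then show ?thesis using m Z0 by simp
  qed
  have "\<epsilon> * t \<le> \<epsilon> * T" using t \<epsilon> by (intro mult_left_mono)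
  also have "\<dots> \<le> \<epsilon> * T * exp (4 * t)"
    using t \<epsilon> mult_left_mono[of 1 "exp (4 * t)" "\<epsilon> * T"] by simp
  finally have "m / 2 * exp (4 * t) + \<epsilon> * t \<le> (m / 2 + \<epsilon> * T) * exp (4 * t)"
    by (simp add: distrib_right)
  with main[of 1] main[of "-1"] show ?thesis by (simp add: abs_le_iff)
qed

text \<open>In the norm with weight \<open>exp (-4 t)\<close> the solution operator of the Cauchy problem is a
  contraction with factor 1/2; this yields the bound below, hence uniqueness.\<close>

lemma cauchy_problem_bound:
  fixes Z :: "'a \<Rightarrow> real \<Rightarrow> real"
  assumes cont: "\<And>t. 0 \<le> t \<Longrightarrow> continuous_on UNIV (\<lambda>x. Z x t)"
    and contt: "\<And>x. continuous_on {0..T} (Z x)" and Z0: "\<And>x. Z x 0 = 0"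
    and der: "\<And>x t. 0 < t \<Longrightarrow> (Z x has_real_derivative (conv J (\<lambda>y. Z y t) x - Z x t + R x t)) (at t)"
    and R: "\<And>x t. 0 < t \<Longrightarrow> t \<le> T \<Longrightarrow> \<bar>R x t\<bar> \<le> \<epsilon>" and \<epsilon>: "0 \<le> \<epsilon>"
    and bd: "\<And>x t. 0 \<le> t \<Longrightarrow> t \<le> T \<Longrightarrow> \<bar>Z x t\<bar> \<le> M"
    and t: "0 \<le> t" "t \<le> T"
  shows "\<bar>Z x t\<bar> \<le> 2 * \<epsilon> * T * exp (4 * t)"
proof -
  have T: "0 \<le> T" using t by linarith
  have M: "0 \<le> M" using bd[of 0 x] T Z0 by simp
  have eT: "0 \<le> \<epsilon> * T" "0 \<le> T * \<epsilon>" using \<epsilon> T by simp_all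
  \<comment> \<open>Each application of \<open>cauchy_problem_step\<close> halves the constant and
    adds \<open>\<epsilon> * T\<close>; the fixed point of this map is 2
    \<open>\<epsilon> * T\<close>.\<close>
  have *: "\<bar>Z x t\<bar> \<le> (M * (1 / 2) ^ j + 2 * \<epsilon> * T) * exp (4 * t)" if "0 \<le> t" "t \<le> T" for x t j
    using that
  proof (induction j arbitrary: x t)
    case 0
    have "\<bar>Z x t\<bar> \<le> M * 1" using bd 0 by simp
    also have "\<dots> \<le> (M * (1 / 2) ^ 0 + 2 * \<epsilon> * T) * exp (4 * t)"
      using M eT 0 by (intro mult_mono) auto
    finally show ?case .
  next
    case (Suc j)
    have "\<bar>Z x t\<bar> \<le> ((M * (1 / 2) ^ j + 2 * \<epsilon> * T) / 2 + \<epsilon> * T) * exp (4 * t)"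
      by (rule cauchy_problem_step[OF cont contt Z0 der R \<epsilon> Suc.IH _ Suc.prems]) (use M eT in \<open>auto simp: mult.commute\<close>)
    also have "(M * (1 / 2) ^ j + 2 * \<epsilon> * T) / 2 + \<epsilon> * T = M * (1 / 2) ^ Suc j + 2 * \<epsilon> * T"
      by simp
    finally show ?case .
  qed
  have "(\<lambda>j. (M * (1 / 2) ^ j + 2 * \<epsilon> * T) * exp (4 * t)) \<longlonglongrightarrow> (M * 0 + 2 * \<epsilon> * T) * exp (4 * t)"
    by (intro tendsto_intros LIMSEQ_realpow_zero) auto
  moreover have "\<exists>N. \<forall>j\<ge>N. \<bar>Z x t\<bar> \<le> (M * (1 / 2) ^ j + 2 * \<epsilon> * T) * exp (4 * t)"
    using *[OF t] by blast
  ultimately have "\<bar>Z x t\<bar> \<le> (M * 0 + 2 * \<epsilon> * T) * exp (4 * t)" by (rule LIMSEQ_le_const)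
  then show ?thesis by simp
qed

text \<open>\<open>reg k\<close> is the regular part of \<open>lazy\<^sup>k \<delta> = 2\<^bsup>-k\<^esup> \<delta> + reg k\<close>; since
  \<open>exp (t L) = exp (-2 t) exp (2 t lazy)\<close>, the smooth part of the fundamental solution is the
  Poisson average \<open>\<Sum>k. pois t k * reg k\<close>.\<close>

primrec reg :: "nat \<Rightarrow> 'a \<Rightarrow> real" where
  "reg 0 = (\<lambda>x. 0)"
| "reg (Suc k) = (\<lambda>x. (reg k x + (lazy ^^ k) J x) / 2)"

definition pois :: "real \<Rightarrow> nat \<Rightarrow> real" where
  "pois t k = exp (- (2 * t)) * (2 * t) ^ k / fact k"

lemma reg_Suc: "reg (Suc k) x = (reg k x + (lazy ^^ k) J x) / 2"
  by simp

declare reg.simps(2) [simp del]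

lemma reg_Cc: "Cc (reg k)"
proof (induction k)
  case 0
  show ?case by (simp add: Cc_def)
next
  case (Suc k)
  then show ?case by (auto simp: reg.simps(2) intro!: Cc_half Cc_add lazy_pow_Cc J)
qed

text \<open>Convolving J with the k-th lazy power of the Dirac measure gives the k-th lazy power of
  J; the two summands come from the atom and the regular part.\<close>

lemma lazy_pow_J_eq: "(lazy ^^ k) J x = (1 / 2) ^ k * J x + conv J (reg k) x"
proof (induction k arbitrary: x)
  case 0
  show ?case by (simp add: conv_def)
next
  case (Suc k)
  have e: "(lazy ^^ k) J = (\<lambda>x. (1 / 2) ^ k * J x + 1 * conv J (reg k) x)" using Suc by auto
  have T: "Cc (conv J (reg k))" by (intro conv_Cc J reg_Cc)
  have "(lazy ^^ Suc k) J x = (1 / 2) ^ k * lazy J x + lazy (conv J (reg k)) x"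
    unfolding funpow.simps o_def e using lazy_lin[OF J T, of "(1/2)^k" 1] by simp
  also have "lazy (conv J (reg k)) x = conv J (lazy (reg k)) x" by (simp add: conv_lazy_commute reg_Cc)
  \<comment> \<open>The same regular part computed in the other order: \<open>lazy\<close> acts on
    \<open>reg k\<close>, and on the atom, which releases a multiple of J.\<close>
  also have "reg (Suc k) = (\<lambda>x. 1 * lazy (reg k) x + (1 / 2) ^ Suc k * J x)"
  proof
    show "reg (Suc k) x = 1 * lazy (reg k) x + (1 / 2) ^ Suc k * J x" for x
      using Suc[of x] by (simp add: reg_Suc lazy_def[of "reg k"] add_divide_distrib)
  qed
  then have "conv J (reg (Suc k)) x = conv J (lazy (reg k)) x + (1 / 2) ^ Suc k * conv J J x"
    using conv_lin[OF Cc_continuous[OF lazy_Cc[OF reg_Cc[of k]]] Cc_continuous[OF J], of 1 "(1/2) ^ Suc k"] by simp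
  then have "conv J (lazy (reg k)) x = conv J (reg (Suc k)) x - (1 / 2) ^ Suc k * conv J J x" by simp
  also have "(1 / 2) ^ k * lazy J x + (conv J (reg (Suc k)) x - (1 / 2) ^ Suc k * conv J J x)
      = (1 / 2) ^ Suc k * J x + conv J (reg (Suc k)) x"
  proof -
    have "c * ((a + b) / 2) + (d - 1 / 2 * c * b) = 1 / 2 * c * a + d" for a b c d :: real
      by (simp add: field_simps)
    then show ?thesis unfolding lazy_def[of J] power_Suc .
  qed
  finally show ?case .
qed

definition gen_reg :: "nat \<Rightarrow> 'a \<Rightarrow> real" where
  "gen_reg k x = conv J (reg k) x - reg k x"

text \<open>The regular part of the identity L = 2 (A - 1) applied to the k-th lazy power of the
  Dirac measure.\<close>

lemma reg_diff: "2 * (reg (Suc k) x - reg k x) = gen_reg k x + (1 / 2) ^ k * J x"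
  by (simp add: gen_reg_def reg_Suc lazy_pow_J_eq)

lemma gen_reg_Suc: "gen_reg (Suc k) x = (gen_reg k x - 2 * lazy_diff k x) / 2"
proof -
  have "conv J (reg (Suc k)) x = (conv J (reg k) x + conv J ((lazy ^^ k) J) x) / 2"
    using conv_lin[OF Cc_continuous[OF reg_Cc[of k]] Cc_continuous[OF lazy_pow_Cc[OF J, of k]], of "1/2" "1/2"]
    by (simp add: reg.simps(2) add_divide_distrib)
  moreover have "conv J ((lazy ^^ k) J) x - (lazy ^^ k) J x = - 2 * lazy_diff k x"
    by (simp add: lazy_diff_def lazy_def[of "(lazy ^^ k) J"])
  ultimately show ?thesis unfolding gen_reg_def using reg_Suc[of k x] by argo
qed

text \<open>The halving in \<open>gen_reg_Suc\<close> keeps the accumulated bound linear. Since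
  \<open>gen_reg 0\<close> vanishes, the factor is k and not k + 1; this is what makes the Poisson
  average proportional to t.\<close>

lemma gen_reg_bound:
  obtains C where "C > 0" "\<And>k x. \<bar>gen_reg k x\<bar> \<le> C * real k / wt x ^ (DIM('a) + 4)"
proof -
  obtain C where C: "C > 0" "\<And>k x. \<bar>lazy_diff k x\<bar> \<le> C * (real k + 1) / wt x ^ (DIM('a) + 4)"
    by (rule lazy_diff_bound) blast
  have "\<bar>gen_reg k x\<bar> \<le> (2 * C) * real k / wt x ^ (DIM('a) + 4)" for k x
  proof (induction k)
    case 0
    show ?case by (simp add: gen_reg_def conv_def)
  next
    case (Suc k)
    have "\<bar>gen_reg (Suc k) x\<bar> \<le> ((2 * C) * real k / wt x ^ (DIM('a) + 4) + 2 * (C * (real k + 1) / wt x ^ (DIM('a) + 4))) / 2"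
      unfolding gen_reg_Suc using Suc.IH C(2)[of k x] by simp
    also have "\<dots> = C * (2 * real k + 1) / wt x ^ (DIM('a) + 4)"
    proof -
      have "(2 * C * k / w + 2 * (C * (k + 1) / w)) / 2 = C * (2 * k + 1) / w" for k w :: real
        by (simp add: algebra_simps add_divide_distrib)
      then show ?thesis .
    qed
    also have "\<dots> \<le> C * (2 * real (Suc k)) / wt x ^ (DIM('a) + 4)"
      using C wt_pos[of x] by (intro divide_right_mono mult_left_mono) auto
    finally show ?case by (simp add: mult_ac)
  qed
  then show ?thesis using that[of "2 * C"] C by simp
qed

lemma reg_sup:
  assumes "\<And>x. \<bar>J x\<bar> \<le> M"
  shows "\<bar>reg k x\<bar> \<le> M"
proof -
  have "\<bar>(lazy ^^ k) J x\<bar> \<le> M" for k x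
    by (induction k arbitrary: x) (auto intro: assms lazy_sup Cc_continuous lazy_pow_Cc J)
  then show ?thesis
  proof (induction k)
    case 0
    then show ?case using order_trans[OF abs_ge_zero assms] by simp
  next
    case (Suc k)
    then have "\<bar>reg k x\<bar> \<le> M" "\<bar>(lazy ^^ k) J x\<bar> \<le> M" by blast+
    then show ?case unfolding reg_Suc by simp
  qed
qed

section \<open>Poisson weights and the truncated series\<close>

lemma pois_nonneg: "0 \<le> t \<Longrightarrow> 0 \<le> pois t k"
  by (simp add: pois_def)

lemma pois_Suc: "real (Suc k) * pois t (Suc k) = 2 * t * pois t k"
  by (simp add: pois_def fact_Suc field_simps del: of_nat_Suc)

lemma pois_0_left: "k > 0 \<Longrightarrow> pois 0 k = 0"
  by (simp add: pois_def)

lemma pois_deriv: "((\<lambda>t. pois t (Suc k)) has_real_derivative 2 * (pois t k - pois t (Suc k))) (at t)"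
proof -
  have "((\<lambda>t. pois t (Suc k)) has_real_derivative
     (exp (- (2 * t)) * (- 2) * (2 * t) ^ Suc k + exp (- (2 * t)) * (real (Suc k) * (2 * t) ^ k * 2)) / fact (Suc k)) (at t)"
    unfolding pois_def by (rule derivative_eq_intros refl | simp)+
  also have "(exp (- (2 * t)) * (- 2) * (2 * t) ^ Suc k + exp (- (2 * t)) * (real (Suc k) * (2 * t) ^ k * 2)) / fact (Suc k)
     = 2 * (pois t k - pois t (Suc k))"
    by (simp add: pois_def fact_Suc field_simps del: of_nat_Suc)
  finally show ?thesis .
qed

lemma sum_pois_le_1: "0 \<le> t \<Longrightarrow> (\<Sum>k\<le>n. pois t k) \<le> 1"
proof -
  assume t: "0 \<le> t"
  have "(\<Sum>k\<le>n. (2 * t) ^ k / fact k) \<le> exp (2 * t)"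
    using sum_le_suminf[OF summable_exp[of "2 * t"], of "{..n}"] t
    by (simp add: exp_def divide_inverse mult.commute)
  then have "exp (- (2 * t)) * (\<Sum>k\<le>n. (2 * t) ^ k / fact k) \<le> exp (- (2 * t)) * exp (2 * t)"
    by (intro mult_left_mono) auto
  then show ?thesis by (simp add: pois_def sum_distrib_left flip: exp_add)
qed

lemma sum_pois_mean: "0 \<le> t \<Longrightarrow> (\<Sum>k\<le>n. pois t k * real k) \<le> 2 * t"
proof (cases n)
  case 0
  assume "0 \<le> t"
  then show ?thesis using 0 by simp
next
  case (Suc n')
  assume t: "0 \<le> t"
  have "(\<Sum>k\<le>n. pois t k * real k) = (\<Sum>k\<le>n'. pois t (Suc k) * real (Suc k))"
    unfolding Suc sum.atMost_Suc_shift by simp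
  also have "\<dots> = 2 * t * (\<Sum>k\<le>n'. pois t k)"
    by (simp only: mult.commute[of "pois t (Suc _)"] pois_Suc sum_distrib_left)
  also have "\<dots> \<le> 2 * t * 1" using t by (intro mult_left_mono sum_pois_le_1) auto
  finally show ?thesis by simp
qed

definition pois_sum :: "nat \<Rightarrow> 'a \<Rightarrow> real \<Rightarrow> real" where
  "pois_sum n x t = (\<Sum>k\<le>n. pois t k * reg k x)"

text \<open>Summation by parts: the derivative of each weight is a difference of neighbouring
  weights, so truncation leaves one boundary term. The lower end contributes nothing because
  \<open>reg 0\<close> is zero.\<close>

lemma pois_sum_deriv:
  "(pois_sum n x has_real_derivative (\<Sum>k\<le>n. pois t k * (2 * (reg (Suc k) x - reg k x))) - 2 * pois t n * reg (Suc n) x) (at t)"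
proof (induction n)
  case 0
  have "((\<lambda>t. pois t 0 * reg 0 x) has_real_derivative 0) (at t)" by simp
  then show ?case by (simp add: pois_sum_def[abs_def])
next
  case (Suc n)
  have "((\<lambda>t. pois_sum n x t + pois t (Suc n) * reg (Suc n) x) has_real_derivative
     ((\<Sum>k\<le>n. pois t k * (2 * (reg (Suc k) x - reg k x))) - 2 * pois t n * reg (Suc n) x)
      + 2 * (pois t n - pois t (Suc n)) * reg (Suc n) x) (at t)"
    by (intro DERIV_add Suc DERIV_cmult_right pois_deriv)
  moreover have "(\<lambda>t. pois_sum n x t + pois t (Suc n) * reg (Suc n) x) = pois_sum (Suc n) x"
    by (simp add: pois_sum_def fun_eq_iff)
  moreover have "((\<Sum>k\<le>n. pois t k * (2 * (reg (Suc k) x - reg k x))) - 2 * pois t n * reg (Suc n) x)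
      + 2 * (pois t n - pois t (Suc n)) * reg (Suc n) x
     = (\<Sum>k\<le>Suc n. pois t k * (2 * (reg (Suc k) x - reg k x))) - 2 * pois t (Suc n) * reg (Suc (Suc n)) x"
    by (simp add: algebra_simps)
  ultimately show ?case by (simp only:)
qed

lemma pois_sum_Cc: "Cc (\<lambda>x. pois_sum n x t)"
proof (induction n)
  case 0
  show ?case by (simp add: pois_sum_def Cc_def)
next
  case (Suc n)
  have "(\<lambda>x. pois_sum (Suc n) x t) = (\<lambda>x. pois_sum n x t + pois t (Suc n) * reg (Suc n) x)"
    by (simp add: pois_sum_def)
  then show ?case using Cc_add[OF Suc Cc_cmult[OF reg_Cc]] by simp
qed

lemma conv_pois_sum: "conv J (\<lambda>y. pois_sum n y t) x - pois_sum n x t = (\<Sum>k\<le>n. pois t k * gen_reg k x)"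
proof (induction n)
  case 0
  show ?case by (simp add: pois_sum_def gen_reg_def conv_def)
next
  case (Suc n)
  have "(\<lambda>x. pois_sum (Suc n) x t) = (\<lambda>x. 1 * pois_sum n x t + pois t (Suc n) * reg (Suc n) x)"
    by (simp add: pois_sum_def)
  then have "conv J (\<lambda>y. pois_sum (Suc n) y t) x = conv J (\<lambda>y. pois_sum n y t) x + pois t (Suc n) * conv J (reg (Suc n)) x"
    using conv_lin[OF Cc_continuous[OF pois_sum_Cc[of n t]] Cc_continuous[OF reg_Cc[of "Suc n"]], of 1 "pois t (Suc n)" x] by simp
  then show ?case using Suc by (simp add: pois_sum_def gen_reg_def algebra_simps)
qed

section \<open>Comparison of a solution with the truncated series\<close>

definition solution :: "('a \<Rightarrow> real \<Rightarrow> real) \<Rightarrow> bool" where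
  "solution W \<longleftrightarrow>
     (\<forall>t\<ge>0. continuous_on UNIV (\<lambda>x. W x t)) \<and> (\<forall>x. continuous_on {0..} (W x)) \<and>
     (\<forall>T>0. \<exists>M. \<forall>x. \<forall>t\<in>{0..T}. \<bar>W x t\<bar> \<le> M) \<and> (\<forall>x. W x 0 = 0) \<and>
     (\<forall>x. \<forall>t>0. (W x has_real_derivative
        (conv J (\<lambda>y. W y t) x - W x t + exp (- t) * J x)) (at t))"

text \<open>The truncated series solves the Cauchy problem up to an error that tends to 0 uniformly
  on [0, T], so \<open>cauchy_problem_bound\<close> gives convergence to W. The generator of the
  truncation is bounded uniformly in n by the Poisson mean, and the bound passes to the
  limit.\<close>

lemma solution_bound:
  "\<exists>C>0. \<forall>W x t. solution W \<longrightarrow> t > 0 \<longrightarrow>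
     \<bar>conv J (\<lambda>y. W y t) x - W x t\<bar> \<le> C * t / wt x ^ (DIM('a) + 4)"
proof -
  let ?m = "DIM('a) + 4"
  obtain C where C: "C > 0" "\<And>k x. \<bar>gen_reg k x\<bar> \<le> C * real k / wt x ^ ?m"
    by (rule gen_reg_bound) blast
  obtain M where M: "M > 0" "\<And>x. \<bar>J x\<bar> \<le> M"
    using Cc_bounded[OF J] by blast
  have "\<bar>conv J (\<lambda>y. W y T) x - W x T\<bar> \<le> (2 * C) * T / wt x ^ ?m"
    if W: "solution W" and T: "T > 0" for W x T
  proof -
    note W' = W[unfolded solution_def]
    have cont: "continuous_on UNIV (\<lambda>x. W x t)" if "0 \<le> t" for t using W' that by blast
    have contt: "continuous_on {0..} (W x)" for x using W' by blast
    have W0: "W x 0 = 0" for x using W' by blast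
    have der: "(W x has_real_derivative (conv J (\<lambda>y. W y t) x - W x t + exp (- t) * J x)) (at t)"
      if "0 < t" for x t using W' that by blast
    have "\<exists>M. \<forall>x. \<forall>t\<in>{0..T}. \<bar>W x t\<bar> \<le> M" using W' T by blast
    then obtain MW where "\<forall>x. \<forall>t\<in>{0..T}. \<bar>W x t\<bar> \<le> MW" ..
    then have MW: "\<bar>W x t\<bar> \<le> MW" if "0 \<le> t" "t \<le> T" for x t using that by simp
    \<comment> \<open>The first summand bounds the truncation error of the source term exp (-t) J,
      the second the boundary term of \<open>pois_sum_deriv\<close>.\<close>
    define \<epsilon> where "\<epsilon> n = (exp T * (T ^ Suc n / fact (Suc n)) + 2 * ((2 * T) ^ n / fact n)) * M" for n
    have \<epsilon>0: "0 \<le> \<epsilon> n" for n unfolding \<epsilon>_def using M T by (intro mult_nonneg_nonneg add_nonneg_nonneg) auto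
    have lim: "\<epsilon> \<longlonglongrightarrow> 0"
    proof -
      have p: "(\<lambda>n. a ^ n / fact n) \<longlonglongrightarrow> 0" for a :: real
        using summable_LIMSEQ_zero[OF summable_exp[of a]] by (simp add: divide_inverse mult.commute)
      have "\<epsilon> \<longlonglongrightarrow> (exp T * 0 + 2 * 0) * M"
        unfolding \<epsilon>_def[abs_def] by (intro tendsto_intros p LIMSEQ_Suc[OF p])
      then show ?thesis by simp
    qed
    have Z: "\<bar>W x t - pois_sum n x t\<bar> \<le> 2 * \<epsilon> n * T * exp (4 * t)" if t: "0 \<le> t" "t \<le> T" for n x t
    proof (rule cauchy_problem_bound[where Z = "\<lambda>x t. W x t - pois_sum n x t" and M = "MW + M" and
          R = "\<lambda>x t. (exp (- t) - (\<Sum>k\<le>n. pois t k * (1 / 2) ^ k)) * J x + 2 * pois t n * reg (Suc n) x"])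
      show "continuous_on UNIV (\<lambda>x. W x t - pois_sum n x t)" if "0 \<le> t" for t
        by (intro continuous_on_diff cont that Cc_continuous[OF pois_sum_Cc])
      have "continuous_on {0..T} (pois_sum n x)" for x
        by (rule DERIV_continuous_on[OF has_field_derivative_at_within[OF pois_sum_deriv]])
      then show "continuous_on {0..T} (\<lambda>t. W x t - pois_sum n x t)" for x
        by (intro continuous_on_diff continuous_on_subset[OF contt]) auto
      show "W x 0 - pois_sum n x 0 = 0" for x
      proof -
        have "pois 0 k * reg k x = 0" for k by (cases k) (simp_all add: pois_0_left)
        then have "pois_sum n x 0 = 0" unfolding pois_sum_def by (intro sum.neutral ballI)
        then show ?thesis by (simp add: W0)
      qed
      show "((\<lambda>t. W x t - pois_sum n x t) has_real_derivative
          conv J (\<lambda>y. W y t - pois_sum n y t) x - (W x t - pois_sum n x t) +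
          ((exp (- t) - (\<Sum>k\<le>n. pois t k * (1 / 2) ^ k)) * J x + 2 * pois t n * reg (Suc n) x)) (at t)"
        if t: "0 < t" for x t
      proof -
        have 1: "conv J (\<lambda>y. W y t - pois_sum n y t) x = conv J (\<lambda>y. W y t) x - conv J (\<lambda>y. pois_sum n y t) x"
          using conv_lin[OF cont[of t] Cc_continuous[OF pois_sum_Cc[of n t]], of 1 "-1"] t by simp
        have 2: "(\<Sum>k\<le>n. pois t k * (2 * (reg (Suc k) x - reg k x)))
          = (\<Sum>k\<le>n. pois t k * gen_reg k x) + (\<Sum>k\<le>n. pois t k * (1 / 2) ^ k) * J x"
          unfolding reg_diff by (simp add: distrib_left sum.distrib sum_distrib_right mult.assoc)
        show ?thesis
        proof (rule DERIV_cong[OF DERIV_diff[OF der[OF t, of x] pois_sum_deriv[of n x t]]])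
          show "conv J (\<lambda>y. W y t) x - W x t + exp (- t) * J x -
              ((\<Sum>k\<le>n. pois t k * (2 * (reg (Suc k) x - reg k x))) - 2 * pois t n * reg (Suc n) x) =
            conv J (\<lambda>y. W y t - pois_sum n y t) x - (W x t - pois_sum n x t) +
              ((exp (- t) - (\<Sum>k\<le>n. pois t k * (1 / 2) ^ k)) * J x + 2 * pois t n * reg (Suc n) x)"
            using conv_pois_sum[of n t x] unfolding 1 2 left_diff_distrib by linarith
        qed
      qed
      show "\<bar>W x t - pois_sum n x t\<bar> \<le> MW + M" if t: "0 \<le> t" "t \<le> T" for x t
      proof -
        have "\<bar>pois_sum n x t\<bar> \<le> (\<Sum>k\<le>n. \<bar>pois t k * reg k x\<bar>)" unfolding pois_sum_def by (rule sum_abs)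
        also have "\<dots> \<le> (\<Sum>k\<le>n. pois t k * M)"
          by (intro sum_mono) (simp add: abs_mult pois_nonneg t mult_left_mono reg_sup M)
        also have "\<dots> = (\<Sum>k\<le>n. pois t k) * M" by (simp add: sum_distrib_right)
        also have "\<dots> \<le> 1 * M" using M t by (intro mult_right_mono sum_pois_le_1) auto
        finally show ?thesis using MW[OF t, of x] by linarith
      qed
      show "\<bar>(exp (- t) - (\<Sum>k\<le>n. pois t k * (1 / 2) ^ k)) * J x + 2 * pois t n * reg (Suc n) x\<bar> \<le> \<epsilon> n"
        if t: "0 < t" "t \<le> T" for x t
      proof -
        have e1: "exp (- (2 * t)) \<le> 1" using t by simp
        obtain \<tau> where \<tau>: "\<bar>\<tau>\<bar> \<le> \<bar>t\<bar>" "exp t = (\<Sum>k<Suc n. t ^ k / fact k) + exp \<tau> / fact (Suc n) * t ^ Suc n"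
          using Maclaurin_exp_le[of t "Suc n"] by blast
        \<comment> \<open>The atoms add up to exp (-2 t) times a partial sum of exp t, so their
          defect from exp (-t) is a Lagrange remainder.\<close>
        have "(\<Sum>k\<le>n. pois t k * (1 / 2) ^ k) = exp (- (2 * t)) * (\<Sum>k<Suc n. t ^ k / fact k)"
          unfolding sum_distrib_left lessThan_Suc_atMost
          by (intro sum.cong) (auto simp: pois_def power_mult_distrib power_one_over)
        moreover have "exp (- t) = exp (- (2 * t)) * exp t" by (simp flip: exp_add)
        ultimately have "exp (- t) - (\<Sum>k\<le>n. pois t k * (1 / 2) ^ k) = exp (- (2 * t)) * (exp \<tau> / fact (Suc n) * t ^ Suc n)"
          using \<tau>(2) by (simp only: right_diff_distrib[symmetric])  (simp add: algebra_simps)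
        then have "\<bar>exp (- t) - (\<Sum>k\<le>n. pois t k * (1 / 2) ^ k)\<bar> = exp (- (2 * t)) * (exp \<tau> * (t ^ Suc n / fact (Suc n)))"
          using t by (simp add: abs_mult del: fact_Suc)
        also have "\<dots> \<le> 1 * (exp T * (T ^ Suc n / fact (Suc n)))"
          using e1 t \<tau>(1) T by (intro mult_mono divide_right_mono power_mono mult_nonneg_nonneg divide_nonneg_nonneg) auto
        finally have a: "\<bar>exp (- t) - (\<Sum>k\<le>n. pois t k * (1 / 2) ^ k)\<bar> \<le> exp T * (T ^ Suc n / fact (Suc n))" by simp
        have "pois t n = exp (- (2 * t)) * ((2 * t) ^ n / fact n)" by (simp add: pois_def)
        also have "\<dots> \<le> 1 * ((2 * T) ^ n / fact n)"
          using e1 t by (intro mult_mono divide_right_mono power_mono) auto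
        finally have b: "pois t n \<le> (2 * T) ^ n / fact n" by simp
        have "\<bar>(exp (- t) - (\<Sum>k\<le>n. pois t k * (1 / 2) ^ k)) * J x + 2 * pois t n * reg (Suc n) x\<bar>
          \<le> \<bar>exp (- t) - (\<Sum>k\<le>n. pois t k * (1 / 2) ^ k)\<bar> * \<bar>J x\<bar> + 2 * pois t n * \<bar>reg (Suc n) x\<bar>"
          using pois_nonneg[of t n] t by (intro order_trans[OF abs_triangle_ineq]) (simp add: abs_mult)
        also have "\<dots> \<le> (exp T * (T ^ Suc n / fact (Suc n))) * M + 2 * ((2 * T) ^ n / fact n) * M"
          using a b M T t pois_nonneg[of t n] reg_sup[OF M(2), of "Suc n" x]
          by (intro add_mono mult_mono) (auto simp del: fact_Suc power_Suc)
        finally show ?thesis by (simp only: \<epsilon>_def distrib_right)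
      qed
    qed (use t \<epsilon>0 in auto)
    \<comment> \<open>The generator is at most doubling in sup norm, so replacing W by the
      truncation costs twice the bound in \<open>Z\<close>.\<close>
    have main: "\<bar>conv J (\<lambda>y. W y T) x - W x T\<bar> \<le> (2 * C) * T / wt x ^ ?m + 4 * \<epsilon> n * T * exp (4 * T)" for n
    proof -
      have "conv J (\<lambda>y. W y T - pois_sum n y T) x = conv J (\<lambda>y. W y T) x - conv J (\<lambda>y. pois_sum n y T) x"
        using conv_lin[OF cont[of T] Cc_continuous[OF pois_sum_Cc[of n T]], of 1 "-1"] T by simp
      moreover have "\<bar>conv J (\<lambda>y. W y T - pois_sum n y T) x\<bar> \<le> 2 * \<epsilon> n * T * exp (4 * T)"
        using T by (intro conv_sup Z continuous_on_diff cont Cc_continuous[OF pois_sum_Cc]) auto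
      moreover have "\<bar>W x T - pois_sum n x T\<bar> \<le> 2 * \<epsilon> n * T * exp (4 * T)" using T by (intro Z) auto
      moreover have "\<bar>conv J (\<lambda>y. pois_sum n y T) x - pois_sum n x T\<bar> \<le> (2 * C) * T / wt x ^ ?m"
      proof -
        have "\<bar>conv J (\<lambda>y. pois_sum n y T) x - pois_sum n x T\<bar> \<le> (\<Sum>k\<le>n. \<bar>pois T k * gen_reg k x\<bar>)"
          unfolding conv_pois_sum by (rule sum_abs)
        also have "\<dots> \<le> (\<Sum>k\<le>n. pois T k * (C * real k / wt x ^ ?m))"
          unfolding abs_mult using T by (intro sum_mono mult_mono C) (auto simp: pois_nonneg)
        also have "\<dots> = (C / wt x ^ ?m) * (\<Sum>k\<le>n. pois T k * real k)"
          by (simp add: sum_distrib_left sum_divide_distrib mult_ac)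
        also have "\<dots> \<le> (C / wt x ^ ?m) * (2 * T)"
          using C wt_pos[of x] T by (intro mult_left_mono sum_pois_mean) auto
        finally show ?thesis by (simp add: mult_ac)
      qed
      ultimately show ?thesis by argo
    qed
    have "(\<lambda>n. (2 * C) * T / wt x ^ ?m + 4 * \<epsilon> n * T * exp (4 * T)) \<longlonglongrightarrow> (2 * C) * T / wt x ^ ?m + 4 * 0 * T * exp (4 * T)"
      by (intro tendsto_intros lim)
    from LIMSEQ_le_const[OF this] main show ?thesis by simp
  qed
  moreover have "2 * C > 0" using C(1) by simp
  ultimately show ?thesis by blast
qed

end

section \<open>Transfer to the original definitions\<close>

lemma dispersal_kernel_imp_symmetric_kernel:
  assumes "dispersal_kernel J"
  shows "symmetric_kernel J"
proof
  have "smooth_on UNIV J" using assms unfolding dispersal_kernel_def by blast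
  then have "Ck_on 0 UNIV J" unfolding smooth_on_def by (rule spec)
  then have "continuous_on UNIV J" by simp
  have "compact (closure {x. J x \<noteq> 0})" using assms unfolding dispersal_kernel_def by blast
  then have "bounded {x. J x \<noteq> 0}" by (rule bounded_subset[OF compact_imp_bounded closure_subset])
  then obtain R where "\<And>x. J x \<noteq> 0 \<Longrightarrow> norm x \<le> R" unfolding bounded_iff by blast
  then have "\<forall>x. R < norm x \<longrightarrow> J x = 0" by force
  with \<open>continuous_on UNIV J\<close> show "Cc J" unfolding Cc_def by blast
  have "\<forall>x y. norm x = norm y \<longrightarrow> J x = J y" using assms unfolding dispersal_kernel_def by blast
  then show "J (- x) = J x" for x by (meson norm_minus_cancel)
  show "0 \<le> J x" "integral\<^sup>L lborel J = 1" for x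
    using assms unfolding dispersal_kernel_def by blast+
qed

text \<open>Mass one turns the integral of \<open>J (x - y) * u x\<close> over y into
  \<open>u x\<close>; compact support of J and continuity of \<open>u\<close> make both parts
  integrable.\<close>

lemma nonlocal_op_eq:
  assumes "symmetric_kernel J" "continuous_on UNIV u"
  shows "nonlocal_op J u x = conv J u x - u x"
proof -
  interpret symmetric_kernel J by fact
  have "nonlocal_op J u x = conv J (\<lambda>y. 1 * u y + (- u x) * 1) x"
    by (simp add: nonlocal_op_def conv_def)
  also have "\<dots> = conv J u x - u x"
    using conv_lin[OF assms(2) continuous_on_const[of UNIV 1], of 1 "- u x"] conv_const[of 1] by simp
  finally show ?thesis .
qed

theorem theorem2p3:
  fixes J :: "real ^ 'n \<Rightarrow> real"
  assumes "dispersal_kernel J"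
  shows "\<exists>C>0. \<forall>W. smooth_part_of_fundamental_solution J W \<longrightarrow>
           (\<forall>x t. t > 0 \<longrightarrow>
              \<bar>deriv (W x) t\<bar> \<le> exp (- t) * J x + C * (t / (1 + norm x) ^ (CARD('n) + 4)))"
proof -
  let ?m = "CARD('n) + 4"
  have ker: "symmetric_kernel J" using assms by (rule dispersal_kernel_imp_symmetric_kernel)
  interpret symmetric_kernel J by (rule ker)
  obtain C where C: "C > 0" and bound: "\<forall>W x t. solution W \<longrightarrow> t > 0 \<longrightarrow>
     \<bar>conv J (\<lambda>y. W y t) x - W x t\<bar> \<le> C * t / wt x ^ (DIM(real ^ 'n) + 4)"
    using solution_bound by (elim exE conjE)
  show ?thesis
  \<comment> \<open>The factor \<open>2 ^ ?m\<close> pays for replacing \<open>wt x\<close> by 1 +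
    norm x, which is at most 2 \<open>wt x\<close>.\<close>
  proof (intro exI[of _ "C * 2 ^ ?m"] conjI allI impI)
    show "C * 2 ^ ?m > 0" using C by simp
    fix W x and t :: real assume W: "smooth_part_of_fundamental_solution J W" and t: "t > 0"
    note W' = W[unfolded smooth_part_of_fundamental_solution_def]
    have joint: "continuous_on (UNIV \<times> {0..}) (\<lambda>(x, t). W x t)" using W' by blast
    have cont: "continuous_on UNIV (\<lambda>x. W x t)" if "0 \<le> t" for t
    proof -
      have "continuous_on UNIV (\<lambda>x::real ^ 'n. (x, t))" by (intro continuous_intros)
      from continuous_on_compose2[OF joint this] that show ?thesis by auto
    qed
    have contt: "continuous_on {0..} (W x)" for x
    proof -
      have "continuous_on {0..} (\<lambda>t. (x, t))" by (intro continuous_intros)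
      from continuous_on_compose2[OF joint this] show ?thesis by auto
    qed
    have der: "(W x has_real_derivative (conv J (\<lambda>y. W y t) x - W x t + exp (- t) * J x)) (at t)" if "0 < t" for x t
      using W' that by (simp add: nonlocal_op_eq[OF ker cont])
    have sol: "solution W"
      unfolding solution_def using cont contt der W' by blast
    have "\<bar>conv J (\<lambda>y. W y t) x - W x t\<bar> \<le> C * t / wt x ^ (DIM(real ^ 'n) + 4)"
      using bound sol t by blast
    also have "\<dots> \<le> C * 2 ^ ?m * (t / (1 + norm x) ^ ?m)"
    proof -
      have "(1 + norm x) ^ ?m \<le> (2 * wt x) ^ ?m"
        using norm_le_wt[of x] wt_ge_1[of x] by (intro power_mono) auto
      then have "1 / wt x ^ ?m \<le> 2 ^ ?m / (1 + norm x) ^ ?m"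
        using wt_pos[of x] by (simp add: power_mult_distrib field_simps add_pos_nonneg)
      from mult_left_mono[OF this, of "C * t"] show ?thesis
        using C t by (simp add: mult_ac)
    qed
    finally show "\<bar>deriv (W x) t\<bar> \<le> exp (- t) * J x + C * 2 ^ ?m * (t / (1 + norm x) ^ ?m)"
      using DERIV_imp_deriv[OF der[OF t, of x]] J_nonneg[of x]
        abs_triangle_ineq[of "conv J (\<lambda>y. W y t) x - W x t" "exp (- t) * J x"]
      by (simp add: abs_mult)
  qed
qed

end
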